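(* Let $G$ be a countable virtually abelian group. Then the complex group algebra $\mathbb CG$ is CCR.
   Context: A group is virtually abelian if it contains an abelian subgroup of finite index. Modules are left modules. A module $M$ over a ring $R$ is simple if $RM\ne0$ and its only submodules are $0$ and $M$. A ring is primitive if it has a faithful simple module. A ring $R$ is simple if $R^2\neq 0$ and it has no proper non-zero two-sided ideals. A minimal left ideal is a simple submodule of the left regular module $R$. A ring is CCR if every primitive quotient ring of it is simple and has a minimal left ideal. *)

theory Defs
  imports "HOL-Algebra.QuotRing" "HOL-Algebra.Module" "HOL-Library.Countable_Set" Complex_Main
begin

definition virtually_abelian :: "('g, 'b) monoid_scheme \<Rightarrow> bool" where
  "virtually_abelian G \<longleftrightarrow>
     (\<exists>H. subgroup H G \<and> comm_group (G\<lparr>carrier := H\<rparr>) \<and> finite (rcosets\<^bsub>G\<^esub> H))"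


text \<open>The library locale \<^locale>\<open>module\<close> is for unital modules over commutative rings.
  As usual when simplicity is defined through \<open>RM \<noteq> 0\<close>, modules are not assumed to be unital.
  The fields \<^const>\<open>mult\<close> and \<^const>\<open>one\<close> of a module record play no role.\<close>

locale left_module = R?: ring R + M?: abelian_group M
  for R :: "('a, 'r) ring_scheme" (structure) and M :: "('a, 'b, 'm) module_scheme" (structure) +
  assumes smult_closed:
      "\<lbrakk>a \<in> carrier R; x \<in> carrier M\<rbrakk> \<Longrightarrow> a \<odot>\<^bsub>M\<^esub> x \<in> carrier M"
    and smult_l_distr:
      "\<lbrakk>a \<in> carrier R; b \<in> carrier R; x \<in> carrier M\<rbrakk> \<Longrightarrow>
        (a \<oplus>\<^bsub>R\<^esub> b) \<odot>\<^bsub>M\<^esub> x = a \<odot>\<^bsub>M\<^esub> x \<oplus>\<^bsub>M\<^esub> b \<odot>\<^bsub>M\<^esub> x"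
    and smult_r_distr:
      "\<lbrakk>a \<in> carrier R; x \<in> carrier M; y \<in> carrier M\<rbrakk> \<Longrightarrow>
        a \<odot>\<^bsub>M\<^esub> (x \<oplus>\<^bsub>M\<^esub> y) = a \<odot>\<^bsub>M\<^esub> x \<oplus>\<^bsub>M\<^esub> a \<odot>\<^bsub>M\<^esub> y"
    and smult_assoc:
      "\<lbrakk>a \<in> carrier R; b \<in> carrier R; x \<in> carrier M\<rbrakk> \<Longrightarrow>
        (a \<otimes>\<^bsub>R\<^esub> b) \<odot>\<^bsub>M\<^esub> x = a \<odot>\<^bsub>M\<^esub> (b \<odot>\<^bsub>M\<^esub> x)"

definition simple_module :: "('a, 'r) ring_scheme \<Rightarrow> ('a, 'b, 'm) module_scheme \<Rightarrow> bool" where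
  "simple_module R M \<longleftrightarrow> left_module R M \<and>
     (\<exists>a\<in>carrier R. \<exists>x\<in>carrier M. a \<odot>\<^bsub>M\<^esub> x \<noteq> \<zero>\<^bsub>M\<^esub>) \<and>
     (\<forall>N. submodule N R M \<longrightarrow> N = {\<zero>\<^bsub>M\<^esub>} \<or> N = carrier M)"

definition faithful_module :: "('a, 'r) ring_scheme \<Rightarrow> ('a, 'b, 'm) module_scheme \<Rightarrow> bool" where
  "faithful_module R M \<longleftrightarrow> left_module R M \<and>
     (\<forall>a\<in>carrier R. (\<forall>x\<in>carrier M. a \<odot>\<^bsub>M\<^esub> x = \<zero>\<^bsub>M\<^esub>) \<longrightarrow> a = \<zero>\<^bsub>R\<^esub>)"

text \<open>The bound module has elements of type \<^typ>\<open>'a set\<close>, where \<^typ>\<open>'a\<close> is the element type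
  of the ring. This is no restriction: by \<open>primitive_ringI\<close> below, a faithful simple module over
  any other type gives one over this type.\<close>

definition primitive_ring :: "('a, 'r) ring_scheme \<Rightarrow> bool" where
  "primitive_ring R \<longleftrightarrow>
     (\<exists>M :: ('a, 'a set) module. simple_module R M \<and> faithful_module R M)"

definition simple_ring :: "('a, 'r) ring_scheme \<Rightarrow> bool" where
  "simple_ring R \<longleftrightarrow> ring R \<and>
     (\<exists>a\<in>carrier R. \<exists>b\<in>carrier R. a \<otimes>\<^bsub>R\<^esub> b \<noteq> \<zero>\<^bsub>R\<^esub>) \<and>
     (\<forall>I. ideal I R \<longrightarrow> I = {\<zero>\<^bsub>R\<^esub>} \<or> I = carrier R)"

definition left_regular_module :: "('a, 'r) ring_scheme \<Rightarrow> ('a, 'a) module" where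
  "left_regular_module R =
     \<lparr>carrier = carrier R, mult = mult R, one = one R, zero = zero R, add = add R,
      smult = mult R\<rparr>"

definition minimal_left_ideal :: "'a set \<Rightarrow> ('a, 'r) ring_scheme \<Rightarrow> bool" where
  "minimal_left_ideal L R \<longleftrightarrow>
     submodule L R (left_regular_module R) \<and>
     simple_module R ((left_regular_module R)\<lparr>carrier := L\<rparr>)"

definition CCR_ring :: "('a, 'r) ring_scheme \<Rightarrow> bool" where
  "CCR_ring R \<longleftrightarrow> ring R \<and>
     (\<forall>I. ideal I R \<and> primitive_ring (R Quot I) \<longrightarrow>
        simple_ring (R Quot I) \<and> (\<exists>L. minimal_left_ideal L (R Quot I)))"


text \<open>Elements are the finitely supported functions on \<open>G\<close>, extended by \<open>0\<close> outside
  \<^term>\<open>carrier G\<close>.\<close>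

definition group_algebra :: "('g, 'b) monoid_scheme \<Rightarrow> ('g \<Rightarrow> complex) ring" where
  "group_algebra G =
     \<lparr>carrier = {f. finite {x. f x \<noteq> 0} \<and> {x. f x \<noteq> 0} \<subseteq> carrier G},
      mult = (\<lambda>f g x. \<Sum>(y, z) | f y \<noteq> 0 \<and> g z \<noteq> 0 \<and> y \<otimes>\<^bsub>G\<^esub> z = x. f y * g z),
      one = (\<lambda>x. if x = \<one>\<^bsub>G\<^esub> then 1 else 0),
      zero = (\<lambda>x. 0),
      add = (\<lambda>f g x. f x + g x)\<rparr>"


subsection \<open>Independence of primitivity from the element type of the module\<close>

lemma simple_module_generated:
  fixes R :: "('a, 'r) ring_scheme" (structure) and M :: "('a, 'b, 'm) module_scheme" (structure)
  assumes "simple_module R M"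
  obtains m where "m \<in> carrier M" "(\<lambda>a. a \<odot>\<^bsub>M\<^esub> m) ` carrier R = carrier M"
proof -
  interpret left_module R M using assms by (simp add: simple_module_def)
  obtain a m where am: "a \<in> carrier R" "m \<in> carrier M" "a \<odot>\<^bsub>M\<^esub> m \<noteq> \<zero>\<^bsub>M\<^esub>"
    using assms unfolding simple_module_def by blast
  let ?N = "(\<lambda>a. a \<odot>\<^bsub>M\<^esub> m) ` carrier R"
  have "submodule ?N R M"
  proof (intro submodule.intro M.add.subgroupI submodule_axioms.intro)
    show "?N \<subseteq> carrier M" using am smult_closed by auto
    show "?N \<noteq> {}" using am by auto
    show "\<ominus>\<^bsub>M\<^esub> x \<in> ?N" if xN: "x \<in> ?N" for x
    proof -
      obtain b where b: "b \<in> carrier R" "x = b \<odot>\<^bsub>M\<^esub> m" using xN by blast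
      have z: "\<zero>\<^bsub>R\<^esub> \<odot>\<^bsub>M\<^esub> m = \<zero>\<^bsub>M\<^esub>"
        using smult_l_distr[of "\<zero>\<^bsub>R\<^esub>" "\<zero>\<^bsub>R\<^esub>" m] am smult_closed[of "\<zero>\<^bsub>R\<^esub>" m]
        by simp
      have "(\<ominus>\<^bsub>R\<^esub> b) \<odot>\<^bsub>M\<^esub> m \<oplus>\<^bsub>M\<^esub> x = \<zero>\<^bsub>M\<^esub>"
        using smult_l_distr[of "\<ominus>\<^bsub>R\<^esub> b" b m] b am z by (simp add: R.l_neg)
      hence "\<ominus>\<^bsub>M\<^esub> x = (\<ominus>\<^bsub>R\<^esub> b) \<odot>\<^bsub>M\<^esub> m"
        using b am smult_closed by (intro M.minus_equality) auto
      thus ?thesis using b by auto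
    qed
    show "x \<oplus>\<^bsub>M\<^esub> y \<in> ?N" if "x \<in> ?N" "y \<in> ?N" for x y
      using that am by (auto simp: smult_l_distr[symmetric])
    show "b \<odot>\<^bsub>M\<^esub> x \<in> ?N" if "b \<in> carrier R" "x \<in> ?N" for b x
      using that am by (auto simp: smult_assoc[symmetric])
  qed
  hence "?N = {\<zero>\<^bsub>M\<^esub>} \<or> ?N = carrier M"
    using assms unfolding simple_module_def by blast
  with am that show thesis by (metis image_eqI singletonD)
qed

lemma primitive_ringI:
  fixes R :: "('a, 'r) ring_scheme" and M :: "('a, 'b, 'm) module_scheme"
  assumes simple: "simple_module R M" and faithful: "faithful_module R M"
  shows "primitive_ring R"
proof -
  interpret left_module R M using simple by (simp add: simple_module_def)
  obtain m where m: "m \<in> carrier M" "(\<lambda>a. a \<odot>\<^bsub>M\<^esub> m) ` carrier R = carrier M"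
    using simple_module_generated[OF simple] by blast
  define f where "f x = {a \<in> carrier R. a \<odot>\<^bsub>M\<^esub> m = x}" for x
  define g where "g A = (THE x. x \<in> carrier M \<and> f x = A)" for A
  have inj: "x = y" if "x \<in> carrier M" "f x = f y" for x y
  proof -
    have "x \<in> (\<lambda>a. a \<odot>\<^bsub>M\<^esub> m) ` carrier R" using that(1) m(2) by simp
    then obtain a where a: "a \<in> carrier R" "x = a \<odot>\<^bsub>M\<^esub> m" by (rule imageE)
    hence "a \<in> f x" by (simp add: f_def)
    hence "a \<in> f y" by (simp only: that(2))
    with a show ?thesis by (simp add: f_def)
  qed
  have gf [simp]: "g (f x) = x" if "x \<in> carrier M" for x
    unfolding g_def by (rule the_equality) (use that inj in simp_all)
  define M' :: "('a, 'a set) module" where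
    "M' = \<lparr>carrier = f ` carrier M, mult = undefined, one = undefined, zero = f \<zero>\<^bsub>M\<^esub>,
           add = (\<lambda>A B. f (g A \<oplus>\<^bsub>M\<^esub> g B)), smult = (\<lambda>a A. f (a \<odot>\<^bsub>M\<^esub> g A))\<rparr>"
  have M'_simps [simp]: "carrier M' = f ` carrier M" "\<zero>\<^bsub>M'\<^esub> = f \<zero>\<^bsub>M\<^esub>"
      "A \<oplus>\<^bsub>M'\<^esub> B = f (g A \<oplus>\<^bsub>M\<^esub> g B)" "a \<odot>\<^bsub>M'\<^esub> A = f (a \<odot>\<^bsub>M\<^esub> g A)" for a A B
    by (simp_all add: M'_def)
  have ab: "abelian_group M'"
  proof (rule abelian_groupI)
    fix x assume "x \<in> carrier M'"
    then obtain u where u: "u \<in> carrier M" "x = f u" by auto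
    show "\<exists>y\<in>carrier M'. y \<oplus>\<^bsub>M'\<^esub> x = \<zero>\<^bsub>M'\<^esub>"
      using u by (intro bexI[of _ "f (\<ominus>\<^bsub>M\<^esub> u)"]) (auto simp: M.l_neg)
  qed (auto simp: M.a_ac)
  have lm: "left_module R M'"
    by (intro left_module.intro ab left_module_axioms.intro R.ring_axioms)
       (auto simp: smult_closed smult_l_distr smult_r_distr smult_assoc)
  interpret M': abelian_group M' by (rule ab)
  have sub: "N = {\<zero>\<^bsub>M'\<^esub>} \<or> N = carrier M'" if N: "submodule N R M'" for N
  proof -
    interpret N: submodule N R M' by (rule N)
    have Nsub: "N \<subseteq> f ` carrier M" using N.subset by simp
    have "submodule (g ` N) R M"
    proof (intro submodule.intro M.add.subgroupI submodule_axioms.intro)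
      show "g ` N \<subseteq> carrier M" using Nsub by auto
      show "g ` N \<noteq> {}" using N.one_closed by auto
      show "b \<odot>\<^bsub>M\<^esub> x \<in> g ` N" if "b \<in> carrier R" "x \<in> g ` N" for b x
      proof -
        obtain A where A: "A \<in> N" "x = g A" using \<open>x \<in> g ` N\<close> by auto
        have "g A \<in> carrier M" using A Nsub by auto
        hence "g (b \<odot>\<^bsub>M'\<^esub> A) = b \<odot>\<^bsub>M\<^esub> x"
          using A that smult_closed by simp
        thus ?thesis using N.smult_closed[OF that(1) A(1)] by (metis image_eqI)
      qed
      show "x \<oplus>\<^bsub>M\<^esub> y \<in> g ` N" if xy: "x \<in> g ` N" "y \<in> g ` N" for x y
      proof -
        obtain A B where A: "A \<in> N" "x = g A" "B \<in> N" "y = g B" using xy by auto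
        have "g A \<in> carrier M" "g B \<in> carrier M" using A Nsub by auto
        hence "g (A \<oplus>\<^bsub>M'\<^esub> B) = x \<oplus>\<^bsub>M\<^esub> y" using A by simp
        thus ?thesis using N.m_closed[OF A(1,3)] by (metis image_eqI monoid.select_convs(1))
      qed
      show "\<ominus>\<^bsub>M\<^esub> x \<in> g ` N" if x: "x \<in> g ` N" for x
      proof -
        obtain A where A: "A \<in> N" "x = g A" using x by auto
        have xM: "x \<in> carrier M" "A = f x" using A Nsub by auto
        have "\<ominus>\<^bsub>M'\<^esub> A = f (\<ominus>\<^bsub>M\<^esub> x)"
          using xM by (intro M'.minus_equality) (auto simp: M.l_neg)
        moreover have "\<ominus>\<^bsub>M'\<^esub> A \<in> N"
          using N.m_inv_closed[OF A(1)] by (simp add: a_inv_def)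
        ultimately have "g (f (\<ominus>\<^bsub>M\<^esub> x)) \<in> g ` N" by simp
        thus ?thesis using xM by simp
      qed
    qed
    hence "g ` N = {\<zero>\<^bsub>M\<^esub>} \<or> g ` N = carrier M"
      using simple unfolding simple_module_def by blast
    moreover have "N = f ` g ` N" using Nsub by (force simp: image_image)
    ultimately show ?thesis by auto
  qed
  obtain a x where ax: "a \<in> carrier R" "x \<in> carrier M" "a \<odot>\<^bsub>M\<^esub> x \<noteq> \<zero>\<^bsub>M\<^esub>"
    using simple unfolding simple_module_def by blast
  have "f (a \<odot>\<^bsub>M\<^esub> x) \<noteq> f \<zero>\<^bsub>M\<^esub>" using inj ax smult_closed by blast
  hence "simple_module R M'"
    using lm sub ax unfolding simple_module_def by auto
  moreover have "faithful_module R M'"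
    unfolding faithful_module_def
  proof (intro conjI lm ballI impI)
    fix a assume a: "a \<in> carrier R" "\<forall>x\<in>carrier M'. a \<odot>\<^bsub>M'\<^esub> x = \<zero>\<^bsub>M'\<^esub>"
    have "a \<odot>\<^bsub>M\<^esub> x = \<zero>\<^bsub>M\<^esub>" if "x \<in> carrier M" for x
      using a that inj smult_closed by auto
    thus "a = \<zero>\<^bsub>R\<^esub>" using faithful a unfolding faithful_module_def by blast
  qed
  ultimately show ?thesis unfolding primitive_ring_def by blast
qed


subsection \<open>The group algebra is a ring\<close>

lemma group_algebra_mult_eq:
  fixes G (structure)
  assumes "finite S" "{x. f x \<noteq> 0} \<subseteq> S" "finite T" "{x. g x \<noteq> 0} \<subseteq> T"
  shows "(f \<otimes>\<^bsub>group_algebra G\<^esub> g) x =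
    (\<Sum>y\<in>S. \<Sum>z\<in>T. if y \<otimes> z = x then f y * g z else 0)"
proof -
  have "(\<Sum>y\<in>S. \<Sum>z\<in>T. if y \<otimes> z = x then f y * g z else 0) =
     (\<Sum>(y, z)\<in>S \<times> T. if y \<otimes> z = x then f y * g z else 0)"
    by (simp add: sum.cartesian_product)
  also have "\<dots> = (\<Sum>(y, z) | f y \<noteq> 0 \<and> g z \<noteq> 0 \<and> y \<otimes> z = x. f y * g z)"
    using assms by (intro sum.mono_neutral_cong_right) (auto split: if_splits)
  finally show ?thesis by (simp add: group_algebra_def)
qed

lemma group_algebra_mult_closed:
  fixes G (structure)
  assumes "group G" "f \<in> carrier (group_algebra G)" "g \<in> carrier (group_algebra G)"
  shows "f \<otimes>\<^bsub>group_algebra G\<^esub> g \<in> carrier (group_algebra G)"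
    and "{x. (f \<otimes>\<^bsub>group_algebra G\<^esub> g) x \<noteq> 0} \<subseteq>
           (\<lambda>(y, z). y \<otimes> z) ` ({x. f x \<noteq> 0} \<times> {x. g x \<noteq> 0})" (is "?L \<subseteq> ?R")
proof -
  interpret group G by fact
  show *: "?L \<subseteq> ?R"
  proof
    fix x assume "x \<in> ?L"
    hence "(\<Sum>(y, z) | f y \<noteq> 0 \<and> g z \<noteq> 0 \<and> y \<otimes> z = x. f y * g z) \<noteq> 0"
      by (simp add: group_algebra_def)
    then obtain p where "p \<in> {(y, z). f y \<noteq> 0 \<and> g z \<noteq> 0 \<and> y \<otimes> z = x}"
      by (rule sum.not_neutral_contains_not_neutral)
    thus "x \<in> ?R" by force
  qed
  have f: "finite {x. f x \<noteq> 0}" "{x. f x \<noteq> 0} \<subseteq> carrier G"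
    and g: "finite {x. g x \<noteq> 0}" "{x. g x \<noteq> 0} \<subseteq> carrier G"
    using assms by (simp_all add: group_algebra_def)
  have "finite ?R" using f g by auto
  moreover have "?R \<subseteq> carrier G" using f g by auto
  ultimately have "finite ?L \<and> ?L \<subseteq> carrier G" by (intro conjI finite_subset[OF *] subset_trans[OF *])
  thus "f \<otimes>\<^bsub>group_algebra G\<^esub> g \<in> carrier (group_algebra G)"
    by (simp add: group_algebra_def)
qed

lemma group_algebra_ring:
  fixes G :: "('g, 'b) monoid_scheme" (structure)
  assumes "group G"
  shows "ring (group_algebra G)"
proof -
  interpret group G by fact
  let ?A = "group_algebra G"
  let ?s = "\<lambda>f :: _ \<Rightarrow> complex. {x. f x \<noteq> 0}"
  have carr: "f \<in> carrier ?A \<longleftrightarrow> finite (?s f) \<and> ?s f \<subseteq> carrier G" for f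
    by (simp add: group_algebra_def)
  have add: "f \<oplus>\<^bsub>?A\<^esub> g = (\<lambda>x. f x + g x)" "\<zero>\<^bsub>?A\<^esub> = (\<lambda>x. 0)"
      "\<one>\<^bsub>?A\<^esub> = (\<lambda>x. if x = \<one> then 1 else 0)" for f g
    by (simp_all add: group_algebra_def)
  have add_closed: "f \<oplus>\<^bsub>?A\<^esub> g \<in> carrier ?A" if "f \<in> carrier ?A" "g \<in> carrier ?A" for f g
  proof -
    have "?s (\<lambda>x. f x + g x) \<subseteq> ?s f \<union> ?s g" by auto
    with that show ?thesis unfolding carr add by (meson finite_UnI finite_subset subset_trans Un_least)
  qed
  have ab: "abelian_group ?A"
  proof (rule abelian_groupI)
    fix f assume "f \<in> carrier ?A"
    thus "\<exists>g\<in>carrier ?A. g \<oplus>\<^bsub>?A\<^esub> f = \<zero>\<^bsub>?A\<^esub>"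
      by (intro bexI[of _ "\<lambda>x. - f x"]) (auto simp: carr add)
  next
    show "\<zero>\<^bsub>?A\<^esub> \<in> carrier ?A" by (simp add: carr add(2))
  qed (simp_all only: add_closed, simp_all add: add add.assoc add.commute add.left_commute)
  have oneA: "\<one>\<^bsub>?A\<^esub> \<in> carrier ?A" by (auto simp: carr add)
  have mon: "monoid ?A"
  proof
    fix f g assume fg: "f \<in> carrier ?A" "g \<in> carrier ?A"
    show "f \<otimes>\<^bsub>?A\<^esub> g \<in> carrier ?A" by (rule group_algebra_mult_closed(1)[OF assms fg])
  next
    show "\<one>\<^bsub>?A\<^esub> \<in> carrier ?A" by (rule oneA)
  next
    fix f assume f: "f \<in> carrier ?A"
    have S: "finite (?s f)" "?s f \<subseteq> carrier G" using f carr by auto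
    have one: "?s \<one>\<^bsub>?A\<^esub> \<subseteq> {\<one>}" by (auto simp: add)
    show "\<one>\<^bsub>?A\<^esub> \<otimes>\<^bsub>?A\<^esub> f = f"
    proof
      fix x
      have "(\<one>\<^bsub>?A\<^esub> \<otimes>\<^bsub>?A\<^esub> f) x = (\<Sum>z\<in>?s f. if z = x then f z else 0)"
      proof (subst group_algebra_mult_eq[OF _ one S(1) order_refl])
        show "finite {\<one>}" by simp
        show "(\<Sum>y\<in>{\<one>}. \<Sum>z\<in>?s f. if y \<otimes> z = x then \<one>\<^bsub>?A\<^esub> y * f z else 0) = (\<Sum>z\<in>?s f. if z = x then f z else 0)"
          unfolding add(3) by (simp, intro sum.cong refl) (use S in \<open>auto split: if_splits\<close>)
      qed
      thus "(\<one>\<^bsub>?A\<^esub> \<otimes>\<^bsub>?A\<^esub> f) x = f x" using S by simp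
    qed
    show "f \<otimes>\<^bsub>?A\<^esub> \<one>\<^bsub>?A\<^esub> = f"
    proof
      fix x
      have "(f \<otimes>\<^bsub>?A\<^esub> \<one>\<^bsub>?A\<^esub>) x = (\<Sum>z\<in>?s f. if z = x then f z else 0)"
      proof (subst group_algebra_mult_eq[OF S(1) order_refl _ one])
        show "finite {\<one>}" by simp
        show "(\<Sum>y\<in>?s f. \<Sum>z\<in>{\<one>}. if y \<otimes> z = x then f y * \<one>\<^bsub>?A\<^esub> z else 0) = (\<Sum>z\<in>?s f. if z = x then f z else 0)"
          unfolding add(3) by (intro sum.cong refl) (use S in \<open>auto split: if_splits\<close>)
      qed
      thus "(f \<otimes>\<^bsub>?A\<^esub> \<one>\<^bsub>?A\<^esub>) x = f x" using S by simp
    qed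
  next
    fix f g h assume c: "f \<in> carrier ?A" "g \<in> carrier ?A" "h \<in> carrier ?A"
    have fin: "finite (?s f)" "finite (?s g)" "finite (?s h)"
      and sub: "?s f \<subseteq> carrier G" "?s g \<subseteq> carrier G" "?s h \<subseteq> carrier G" using c carr by auto
    show "(f \<otimes>\<^bsub>?A\<^esub> g) \<otimes>\<^bsub>?A\<^esub> h = f \<otimes>\<^bsub>?A\<^esub> (g \<otimes>\<^bsub>?A\<^esub> h)"
    proof
      fix x
      let ?P = "(\<lambda>(y, z). y \<otimes> z) ` (?s f \<times> ?s g)" and ?Q = "(\<lambda>(y, z). y \<otimes> z) ` (?s g \<times> ?s h)"
      have P: "finite ?P" "finite ?Q" using fin by auto
      have "((f \<otimes>\<^bsub>?A\<^esub> g) \<otimes>\<^bsub>?A\<^esub> h) x =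
          (\<Sum>u\<in>?P. \<Sum>w\<in>?s h. if u \<otimes> w = x then (f \<otimes>\<^bsub>?A\<^esub> g) u * h w else 0)"
        by (rule group_algebra_mult_eq[OF P(1) group_algebra_mult_closed(2)[OF assms c(1,2)] fin(3) order_refl])
      also have "\<dots> = (\<Sum>u\<in>?P. \<Sum>w\<in>?s h. \<Sum>y\<in>?s f. \<Sum>z\<in>?s g.
           if y \<otimes> z = u then if u \<otimes> w = x then f y * g z * h w else 0 else 0)"
      proof (intro sum.cong refl)
        fix u w
        have "(if u \<otimes> w = x then (f \<otimes>\<^bsub>?A\<^esub> g) u * h w else 0) =
            (f \<otimes>\<^bsub>?A\<^esub> g) u * (if u \<otimes> w = x then h w else 0)" by simp
        also have "\<dots> = (\<Sum>y\<in>?s f. \<Sum>z\<in>?s g.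
            (if y \<otimes> z = u then f y * g z else 0) * (if u \<otimes> w = x then h w else 0))"
          unfolding group_algebra_mult_eq[OF fin(1) order_refl fin(2) order_refl]
            sum_distrib_right ..
        also have "\<dots> = (\<Sum>y\<in>?s f. \<Sum>z\<in>?s g.
            if y \<otimes> z = u then if u \<otimes> w = x then f y * g z * h w else 0 else 0)"
          by (intro sum.cong refl) simp
        finally show "(if u \<otimes> w = x then (f \<otimes>\<^bsub>?A\<^esub> g) u * h w else 0) = \<dots>" .
      qed
      also have "\<dots> = (\<Sum>y\<in>?s f. \<Sum>z\<in>?s g. \<Sum>w\<in>?s h. \<Sum>u\<in>?P.
           if y \<otimes> z = u then if u \<otimes> w = x then f y * g z * h w else 0 else 0)"
      proof -
        have swap3: "(\<Sum>u\<in>P. \<Sum>w\<in>W. \<Sum>y\<in>Y. \<Sum>z\<in>Z. F u w y z) = (\<Sum>y\<in>Y. \<Sum>z\<in>Z. \<Sum>w\<in>W. \<Sum>u\<in>P. F u w y z)"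
          for P W Y Z and F :: "'g \<Rightarrow> 'g \<Rightarrow> 'g \<Rightarrow> 'g \<Rightarrow> complex"
        proof -
          have "(\<Sum>u\<in>P. \<Sum>w\<in>W. \<Sum>y\<in>Y. \<Sum>z\<in>Z. F u w y z) = (\<Sum>w\<in>W. \<Sum>u\<in>P. \<Sum>y\<in>Y. \<Sum>z\<in>Z. F u w y z)"
            by (rule sum.swap)
          also have "\<dots> = (\<Sum>w\<in>W. \<Sum>y\<in>Y. \<Sum>u\<in>P. \<Sum>z\<in>Z. F u w y z)"
            by (rule sum.cong[OF refl], rule sum.swap)
          also have "\<dots> = (\<Sum>y\<in>Y. \<Sum>w\<in>W. \<Sum>u\<in>P. \<Sum>z\<in>Z. F u w y z)"
            by (rule sum.swap)
          also have "\<dots> = (\<Sum>y\<in>Y. \<Sum>w\<in>W. \<Sum>z\<in>Z. \<Sum>u\<in>P. F u w y z)"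
            by (rule sum.cong[OF refl], rule sum.cong[OF refl], rule sum.swap)
          also have "\<dots> = (\<Sum>y\<in>Y. \<Sum>z\<in>Z. \<Sum>w\<in>W. \<Sum>u\<in>P. F u w y z)"
            by (rule sum.cong[OF refl], rule sum.swap)
          finally show ?thesis .
        qed
        show ?thesis by (rule swap3)
      qed
      also have "\<dots> = (\<Sum>y\<in>?s f. \<Sum>z\<in>?s g. \<Sum>w\<in>?s h. if y \<otimes> z \<otimes> w = x then f y * g z * h w else 0)"
        using P by (intro sum.cong refl) (subst sum.delta', auto)
      also have "\<dots> = (\<Sum>y\<in>?s f. \<Sum>z\<in>?s g. \<Sum>w\<in>?s h. if y \<otimes> (z \<otimes> w) = x then f y * (g z * h w) else 0)"
      proof (intro sum.cong refl)
        fix y z w assume "y \<in> ?s f" "z \<in> ?s g" "w \<in> ?s h"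
        hence "y \<in> carrier G" "z \<in> carrier G" "w \<in> carrier G" using sub by auto
        thus "(if y \<otimes> z \<otimes> w = x then f y * g z * h w else 0) =
            (if y \<otimes> (z \<otimes> w) = x then f y * (g z * h w) else 0)"
          by (simp add: m_assoc mult.assoc)
      qed
      also have "\<dots> = (\<Sum>y\<in>?s f. \<Sum>z\<in>?s g. \<Sum>w\<in>?s h. \<Sum>u\<in>?Q.
           if z \<otimes> w = u then if y \<otimes> u = x then f y * (g z * h w) else 0 else 0)"
        using P by (intro sum.cong refl) (subst sum.delta', auto)
      also have "\<dots> = (\<Sum>y\<in>?s f. \<Sum>u\<in>?Q. \<Sum>z\<in>?s g. \<Sum>w\<in>?s h.
           if z \<otimes> w = u then if y \<otimes> u = x then f y * (g z * h w) else 0 else 0)"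
      proof (rule sum.cong[OF refl])
        have swap2: "(\<Sum>z\<in>Z. \<Sum>w\<in>W. \<Sum>u\<in>P. F u w z) = (\<Sum>u\<in>P. \<Sum>z\<in>Z. \<Sum>w\<in>W. F u w z)"
          for P W Z and F :: "'g \<Rightarrow> 'g \<Rightarrow> 'g \<Rightarrow> complex"
        proof -
          have "(\<Sum>z\<in>Z. \<Sum>w\<in>W. \<Sum>u\<in>P. F u w z) = (\<Sum>z\<in>Z. \<Sum>u\<in>P. \<Sum>w\<in>W. F u w z)"
            by (rule sum.cong[OF refl], rule sum.swap)
          also have "\<dots> = (\<Sum>u\<in>P. \<Sum>z\<in>Z. \<Sum>w\<in>W. F u w z)"
            by (rule sum.swap)
          finally show ?thesis .
        qed
        fix y
        show "(\<Sum>z\<in>?s g. \<Sum>w\<in>?s h. \<Sum>u\<in>?Q.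
              if z \<otimes> w = u then if y \<otimes> u = x then f y * (g z * h w) else 0 else 0) =
            (\<Sum>u\<in>?Q. \<Sum>z\<in>?s g. \<Sum>w\<in>?s h.
              if z \<otimes> w = u then if y \<otimes> u = x then f y * (g z * h w) else 0 else 0)"
          by (rule swap2)
      qed
      also have "\<dots> = (\<Sum>y\<in>?s f. \<Sum>u\<in>?Q. if y \<otimes> u = x then f y * (g \<otimes>\<^bsub>?A\<^esub> h) u else 0)"
      proof (intro sum.cong refl)
        fix y u
        have "(if y \<otimes> u = x then f y * (g \<otimes>\<^bsub>?A\<^esub> h) u else 0) =
            (if y \<otimes> u = x then f y else 0) * (g \<otimes>\<^bsub>?A\<^esub> h) u" by simp
        also have "\<dots> = (\<Sum>z\<in>?s g. \<Sum>w\<in>?s h.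
            (if y \<otimes> u = x then f y else 0) * (if z \<otimes> w = u then g z * h w else 0))"
          unfolding group_algebra_mult_eq[OF fin(2) order_refl fin(3) order_refl]
            sum_distrib_left ..
        also have "\<dots> = (\<Sum>z\<in>?s g. \<Sum>w\<in>?s h.
            if z \<otimes> w = u then if y \<otimes> u = x then f y * (g z * h w) else 0 else 0)"
          by (intro sum.cong refl) simp
        finally show "(\<Sum>z\<in>?s g. \<Sum>w\<in>?s h.
            if z \<otimes> w = u then if y \<otimes> u = x then f y * (g z * h w) else 0 else 0) =
            (if y \<otimes> u = x then f y * (g \<otimes>\<^bsub>?A\<^esub> h) u else 0)" by (rule sym)
      qed
      also have "\<dots> = (f \<otimes>\<^bsub>?A\<^esub> (g \<otimes>\<^bsub>?A\<^esub> h)) x"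
        by (rule group_algebra_mult_eq[OF fin(1) order_refl P(2) group_algebra_mult_closed(2)[OF assms c(2,3)], symmetric])
      finally show "((f \<otimes>\<^bsub>?A\<^esub> g) \<otimes>\<^bsub>?A\<^esub> h) x = (f \<otimes>\<^bsub>?A\<^esub> (g \<otimes>\<^bsub>?A\<^esub> h)) x" .
    qed
  qed
  show ?thesis
  proof (rule ringI[OF ab mon])
    fix f g h assume c: "f \<in> carrier ?A" "g \<in> carrier ?A" "h \<in> carrier ?A"
    have fin: "finite (?s f)" "finite (?s g)" "finite (?s h)" using c carr by auto
    have U: "finite (?s f \<union> ?s g)" "?s (f \<oplus>\<^bsub>?A\<^esub> g) \<subseteq> ?s f \<union> ?s g"
      "?s f \<subseteq> ?s f \<union> ?s g" "?s g \<subseteq> ?s f \<union> ?s g" using fin by (auto simp: add)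
    show "(f \<oplus>\<^bsub>?A\<^esub> g) \<otimes>\<^bsub>?A\<^esub> h = f \<otimes>\<^bsub>?A\<^esub> h \<oplus>\<^bsub>?A\<^esub> g \<otimes>\<^bsub>?A\<^esub> h"
    proof
      fix x
      show "((f \<oplus>\<^bsub>?A\<^esub> g) \<otimes>\<^bsub>?A\<^esub> h) x = (f \<otimes>\<^bsub>?A\<^esub> h \<oplus>\<^bsub>?A\<^esub> g \<otimes>\<^bsub>?A\<^esub> h) x"
        unfolding add(1)[of "f \<otimes>\<^bsub>?A\<^esub> h"]
          group_algebra_mult_eq[OF U(1) U(2) fin(3) order_refl]
          group_algebra_mult_eq[OF U(1) U(3) fin(3) order_refl]
          group_algebra_mult_eq[OF U(1) U(4) fin(3) order_refl] sum.distrib[symmetric]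
        by (intro sum.cong refl) (simp add: add algebra_simps)
    qed
    show "h \<otimes>\<^bsub>?A\<^esub> (f \<oplus>\<^bsub>?A\<^esub> g) = h \<otimes>\<^bsub>?A\<^esub> f \<oplus>\<^bsub>?A\<^esub> h \<otimes>\<^bsub>?A\<^esub> g"
    proof
      fix x
      show "(h \<otimes>\<^bsub>?A\<^esub> (f \<oplus>\<^bsub>?A\<^esub> g)) x = (h \<otimes>\<^bsub>?A\<^esub> f \<oplus>\<^bsub>?A\<^esub> h \<otimes>\<^bsub>?A\<^esub> g) x"
        unfolding add(1)[of "h \<otimes>\<^bsub>?A\<^esub> f"]
          group_algebra_mult_eq[OF fin(3) order_refl U(1) U(2)]
          group_algebra_mult_eq[OF fin(3) order_refl U(1) U(3)]
          group_algebra_mult_eq[OF fin(3) order_refl U(1) U(4)] sum.distrib[symmetric]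
        by (intro sum.cong refl) (simp add: add algebra_simps)
    qed
  qed
qed

end

theory Submission
  imports Defs "HOL-Library.Function_Algebras" "HOL-Analysis.Continuum_Not_Denumerable"
    "HOL-Computational_Algebra.Fundamental_Theorem_Algebra"
begin

text \<open>Let \<open>M\<close> be a faithful simple module over a quotient \<open>R\<close> of \<open>A = \<complex>G\<close>, write \<open>M \<cong> A / L\<close> with \<open>L\<close> a
  maximal left ideal, and let \<open>H\<close> be an abelian subgroup of finite index. As \<open>A\<close> is finitely
  generated over \<open>\<complex>H\<close>, there is a maximal proper \<open>\<complex>H\<close>-submodule \<open>P \<supseteq> L\<close>. The dimension of \<open>A\<close> is
  countable and \<open>\<complex>\<close> is uncountable and algebraically closed, so \<open>H\<close> acts on \<open>A / P\<close> by scalars and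
  \<open>A / P\<close> is one-dimensional. The intersection of the translates of \<open>P\<close>, of which there are
  finitely many, is a proper left ideal containing \<open>L\<close>, hence equals \<open>L\<close>, and \<open>M\<close> has finite
  dimension. Therefore a finite set of vectors in \<open>M\<close> has zero annihilator in \<open>R\<close>; a minimal such
  set decomposes \<open>R\<close> into minimal left ideals isomorphic to \<open>M\<close>.\<close>

subsection \<open>Simple modules with a finite set of zero annihilator\<close>

lemma (in abelian_group) diff_eq_zeroD:
  assumes "a \<in> carrier G" "b \<in> carrier G" "a \<ominus> b = \<zero>"
  shows "a = b"
proof -
  have "a \<ominus> b \<oplus> b = a" using assms(1,2) by (simp add: a_minus_def a_assoc l_neg)
  thus ?thesis using assms by simp
qed

context left_module
begin

lemma smult_l_zero: "x \<in> carrier M \<Longrightarrow> \<zero>\<^bsub>R\<^esub> \<odot>\<^bsub>M\<^esub> x = \<zero>\<^bsub>M\<^esub>"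
  using smult_l_distr[of "\<zero>\<^bsub>R\<^esub>" "\<zero>\<^bsub>R\<^esub>" x] smult_closed[of "\<zero>\<^bsub>R\<^esub>" x]
  by simp

lemma smult_r_zero: "a \<in> carrier R \<Longrightarrow> a \<odot>\<^bsub>M\<^esub> \<zero>\<^bsub>M\<^esub> = \<zero>\<^bsub>M\<^esub>"
  using smult_r_distr[of a "\<zero>\<^bsub>M\<^esub>" "\<zero>\<^bsub>M\<^esub>"] smult_closed[of a "\<zero>\<^bsub>M\<^esub>"]
  by simp

lemma smult_l_minus:
  assumes "a \<in> carrier R" "x \<in> carrier M"
  shows "(\<ominus>\<^bsub>R\<^esub> a) \<odot>\<^bsub>M\<^esub> x = \<ominus>\<^bsub>M\<^esub> (a \<odot>\<^bsub>M\<^esub> x)"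
proof -
  have "(\<ominus>\<^bsub>R\<^esub> a) \<odot>\<^bsub>M\<^esub> x \<oplus>\<^bsub>M\<^esub> a \<odot>\<^bsub>M\<^esub> x = \<zero>\<^bsub>M\<^esub>"
    using smult_l_distr[of "\<ominus>\<^bsub>R\<^esub> a" a x] assms smult_l_zero by (simp add: R.l_neg)
  thus ?thesis using assms smult_closed by (intro M.minus_equality[symmetric]) auto
qed

lemma smult_l_diff_eq_zero:
  assumes "a \<in> carrier R" "b \<in> carrier R" "x \<in> carrier M" "a \<odot>\<^bsub>M\<^esub> x = b \<odot>\<^bsub>M\<^esub> x"
  shows "(a \<ominus>\<^bsub>R\<^esub> b) \<odot>\<^bsub>M\<^esub> x = \<zero>\<^bsub>M\<^esub>"
  using assms smult_closed[of b x] by (simp add: a_minus_def smult_l_distr smult_l_minus M.r_neg)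

text \<open>Where one acts as the identity, negation is the action of minus one, so closure under
  addition and the action suffices.\<close>

lemma submodule_if_closed:
  assumes "N \<subseteq> carrier M" "N \<noteq> {}"
    and "\<And>x y. x \<in> N \<Longrightarrow> y \<in> N \<Longrightarrow> x \<oplus>\<^bsub>M\<^esub> y \<in> N"
    and "\<And>a x. a \<in> carrier R \<Longrightarrow> x \<in> N \<Longrightarrow> a \<odot>\<^bsub>M\<^esub> x \<in> N"
    and unital: "\<And>x. x \<in> N \<Longrightarrow> \<one>\<^bsub>R\<^esub> \<odot>\<^bsub>M\<^esub> x = x"
  shows "submodule N R M"
proof (intro submodule.intro M.add.subgroupI submodule_axioms.intro)
  show "\<ominus>\<^bsub>M\<^esub> x \<in> N" if "x \<in> N" for x
    using assms(4)[of "\<ominus>\<^bsub>R\<^esub> \<one>\<^bsub>R\<^esub>" x] smult_l_minus[of "\<one>\<^bsub>R\<^esub>" x] that assms(1) unital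
    by auto
qed (use assms in auto)

end

locale simple_left_module = left_module +
  assumes simple: "simple_module R M"
begin

text \<open>Unitality is not an axiom of \<open>left_module\<close>. Simplicity forces it: every
  element is a multiple \<open>a m\<close> of one generator \<open>m\<close>, and 1 (a m) = (1 a)
  m.\<close>

lemma smult_one:
  assumes "x \<in> carrier M"
  shows "\<one>\<^bsub>R\<^esub> \<odot>\<^bsub>M\<^esub> x = x"
proof -
  obtain m where m: "m \<in> carrier M" "(\<lambda>a. a \<odot>\<^bsub>M\<^esub> m) ` carrier R = carrier M"
    using simple_module_generated[OF simple] by blast
  then obtain a where "a \<in> carrier R" "x = a \<odot>\<^bsub>M\<^esub> m" using assms by blast
  thus ?thesis using m(1) smult_assoc[of "\<one>\<^bsub>R\<^esub>" a m] by simp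
qed

text \<open>The multiples of \<open>x\<close> form a submodule, which is nonzero because by
  unitality it contains \<open>x\<close> itself.\<close>

lemma generated:
  assumes "x \<in> carrier M" "x \<noteq> \<zero>\<^bsub>M\<^esub>" "y \<in> carrier M"
  obtains a where "a \<in> carrier R" "a \<odot>\<^bsub>M\<^esub> x = y"
proof -
  let ?N = "(\<lambda>a. a \<odot>\<^bsub>M\<^esub> x) ` carrier R"
  have "submodule ?N R M"
    using assms(1) by (intro submodule_if_closed)
      (auto simp: smult_closed smult_l_distr[symmetric] smult_assoc[symmetric] smult_one)
  moreover have "x \<in> ?N" using smult_one[OF assms(1)] by (metis R.one_closed imageI)
  ultimately have "?N = carrier M" using simple assms(2) unfolding simple_module_def by blast
  hence "y \<in> ?N" using assms(3) by simp
  thus thesis by (rule imageE) (rule that, simp_all)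
qed

end

text \<open>Evaluation on \<open>E\<close> embeds the left module \<open>R\<close> into a finite
  power of \<open>M\<close>. Minimality separates the components: for each \<open>e\<close> in
  \<open>E\<close> some ring element kills all other members of \<open>E\<close> but not
  \<open>e\<close>.\<close>

locale finitely_faithful = simple_left_module +
  fixes E :: "'c set"
  assumes finite_E: "finite E" and E_carrier: "E \<subseteq> carrier M"
    and annihilator_E: "\<lbrakk>a \<in> carrier R; \<And>e. e \<in> E \<Longrightarrow> a \<odot>\<^bsub>M\<^esub> e = \<zero>\<^bsub>M\<^esub>\<rbrakk> \<Longrightarrow> a = \<zero>\<^bsub>R\<^esub>"
    and minimal_E: "F \<subset> E \<Longrightarrow>
      \<exists>a\<in>carrier R. a \<noteq> \<zero>\<^bsub>R\<^esub> \<and> (\<forall>e\<in>F. a \<odot>\<^bsub>M\<^esub> e = \<zero>\<^bsub>M\<^esub>)"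
begin

text \<open>By minimality of \<open>E\<close>, evaluation at \<open>e\<close> maps the left ideal \<open>J e\<close> isomorphically onto \<open>M\<close>.\<close>

definition J :: "'c \<Rightarrow> 'a set" where
  "J e = {a \<in> carrier R. \<forall>f\<in>E - {e}. a \<odot>\<^bsub>M\<^esub> f = \<zero>\<^bsub>M\<^esub>}"

lemma J_carrier: "a \<in> J e \<Longrightarrow> a \<in> carrier R"
  by (simp add: J_def)

lemma J_add: "a \<in> J e \<Longrightarrow> b \<in> J e \<Longrightarrow> a \<oplus>\<^bsub>R\<^esub> b \<in> J e"
  using E_carrier by (auto simp: J_def smult_l_distr subset_iff)

lemma J_mult: "a \<in> carrier R \<Longrightarrow> b \<in> J e \<Longrightarrow> a \<otimes>\<^bsub>R\<^esub> b \<in> J e"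
  using E_carrier by (auto simp: J_def smult_assoc smult_r_zero subset_iff)

lemma J_minus: "a \<in> J e \<Longrightarrow> \<ominus>\<^bsub>R\<^esub> a \<in> J e"
  using E_carrier by (auto simp: J_def smult_l_minus subset_iff)

text \<open>The difference of \<open>a\<close> and \<open>b\<close> kills \<open>e\<close> by
  assumption and the rest of \<open>E\<close> because both lie in \<open>J e\<close>.\<close>

lemma J_eqI:
  assumes "e \<in> E" "a \<in> J e" "b \<in> J e" "a \<odot>\<^bsub>M\<^esub> e = b \<odot>\<^bsub>M\<^esub> e"
  shows "a = b"
proof -
  note J_carrier[OF assms(2)] J_carrier[OF assms(3)]
  moreover have "a \<ominus>\<^bsub>R\<^esub> b = \<zero>\<^bsub>R\<^esub>"
  proof (rule annihilator_E)
    fix f assume f: "f \<in> E"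
    hence "a \<odot>\<^bsub>M\<^esub> f = b \<odot>\<^bsub>M\<^esub> f" using assms by (cases "f = e") (auto simp: J_def)
    thus "(a \<ominus>\<^bsub>R\<^esub> b) \<odot>\<^bsub>M\<^esub> f = \<zero>\<^bsub>M\<^esub>"
      using calculation f E_carrier by (intro smult_l_diff_eq_zero) auto
  qed (use calculation in auto)
  ultimately show ?thesis by (rule R.diff_eq_zeroD)
qed

text \<open>Surjectivity of the evaluation: already the left multiples of a single \<open>j\<close>,
  which stay in \<open>J e\<close>, reach all of \<open>M\<close>.\<close>

lemma J_transitive:
  assumes "e \<in> E" "j \<in> J e" "j \<odot>\<^bsub>M\<^esub> e \<noteq> \<zero>\<^bsub>M\<^esub>" "x \<in> carrier M"
  obtains r where "r \<in> carrier R" "(r \<otimes>\<^bsub>R\<^esub> j) \<odot>\<^bsub>M\<^esub> e = x"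
proof -
  have e: "e \<in> carrier M" using assms E_carrier by auto
  obtain r where "r \<in> carrier R" "r \<odot>\<^bsub>M\<^esub> (j \<odot>\<^bsub>M\<^esub> e) = x"
    using generated[of "j \<odot>\<^bsub>M\<^esub> e" x] assms e smult_closed J_carrier by blast
  thus thesis using that smult_assoc assms(2) e J_carrier by metis
qed

lemma J_nonzero:
  assumes "e \<in> E"
  obtains j where "j \<in> J e" "j \<odot>\<^bsub>M\<^esub> e \<noteq> \<zero>\<^bsub>M\<^esub>"
proof -
  obtain j where j: "j \<in> carrier R" "j \<noteq> \<zero>\<^bsub>R\<^esub>" "\<forall>f\<in>E - {e}. j \<odot>\<^bsub>M\<^esub> f = \<zero>\<^bsub>M\<^esub>"
    using minimal_E[of "E - {e}"] assms by blast
  hence "j \<odot>\<^bsub>M\<^esub> e \<noteq> \<zero>\<^bsub>M\<^esub>" using annihilator_E[of j] by blast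
  with j that show thesis by (auto simp: J_def)
qed

lemma one_not_zero: "\<one>\<^bsub>R\<^esub> \<noteq> \<zero>\<^bsub>R\<^esub>"
  using simple smult_one smult_l_zero R.one_zeroD
  unfolding simple_module_def by (metis M.zero_closed smult_closed smult_r_zero)

text \<open>A nonzero \<open>n\<close> in a submodule \<open>N\<close> of \<open>J e\<close> has
  nonzero value at \<open>e\<close>. Its left multiples then attain every value of \<open>M\<close>,
  and injectivity of evaluation on \<open>J e\<close> identifies each \<open>x\<close> in
  \<open>J e\<close> with such a multiple.\<close>

lemma minimal_left_ideal_J:
  assumes e: "e \<in> E"
  shows "minimal_left_ideal (J e) R"
proof -
  let ?A = "left_regular_module R"
  let ?J = "?A\<lparr>carrier := J e\<rparr>"
  have A: "carrier ?A = carrier R" "add ?A = add R" "zero ?A = zero R" "module.smult ?A = monoid.mult R"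
    by (simp_all add: left_regular_module_def)
  have e': "e \<in> carrier M" using e E_carrier by auto
  have ab: "abelian_group ?A"
  proof (rule abelian_groupI)
    fix x assume "x \<in> carrier ?A"
    thus "\<exists>y\<in>carrier ?A. y \<oplus>\<^bsub>?A\<^esub> x = \<zero>\<^bsub>?A\<^esub>"
      by (auto simp: A R.l_neg intro!: bexI[of _ "\<ominus>\<^bsub>R\<^esub> x"])
  qed (simp_all add: A R.a_ac)
  interpret A: left_module R ?A
    by (intro left_module.intro R.ring_axioms ab left_module_axioms.intro)
      (auto simp: A R.l_distr R.r_distr R.m_assoc)
  have z: "\<zero>\<^bsub>R\<^esub> \<in> J e" using E_carrier by (auto simp: J_def smult_l_zero)
  have "submodule (J e) R ?A"
    using z by (intro A.submodule_if_closed) (auto simp: A J_add J_mult J_carrier)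
  have abJ: "abelian_group ?J"
  proof (rule abelian_groupI)
    fix x assume "x \<in> carrier ?J"
    thus "\<exists>y\<in>carrier ?J. y \<oplus>\<^bsub>?J\<^esub> x = \<zero>\<^bsub>?J\<^esub>"
      by (auto simp: A J_carrier R.l_neg intro!: bexI[of _ "\<ominus>\<^bsub>R\<^esub> x"] J_minus)
  qed (simp_all add: A J_add J_carrier R.a_ac z)
  interpret J: left_module R ?J
    by (intro left_module.intro R.ring_axioms abJ left_module_axioms.intro)
      (auto simp: A J_mult J_carrier R.l_distr R.r_distr R.m_assoc)
  obtain j where j: "j \<in> J e" "j \<odot>\<^bsub>M\<^esub> e \<noteq> \<zero>\<^bsub>M\<^esub>" using J_nonzero[OF e] .
  have "simple_module R ?J"
    unfolding simple_module_def
  proof (intro conjI allI impI J.left_module_axioms)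
    have "j \<noteq> \<zero>\<^bsub>R\<^esub>" using j e' smult_l_zero by blast
    thus "\<exists>a\<in>carrier R. \<exists>x\<in>carrier ?J. a \<odot>\<^bsub>?J\<^esub> x \<noteq> \<zero>\<^bsub>?J\<^esub>"
      using j J_carrier by (intro bexI[of _ "\<one>\<^bsub>R\<^esub>"] bexI[of _ j]) (auto simp: A)
  next
    fix N assume "submodule N R ?J"
    then interpret N: submodule N R ?J .
    have NJ: "N \<subseteq> J e" using N.subset by simp
    have zN: "\<zero>\<^bsub>R\<^esub> \<in> N" using N.one_closed by (simp add: A)
    show "N = {\<zero>\<^bsub>?J\<^esub>} \<or> N = carrier ?J"
    proof (cases "N \<subseteq> {\<zero>\<^bsub>R\<^esub>}")
      case True
      thus ?thesis using zN by (auto simp: A)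
    next
      case False
      then obtain n where n: "n \<in> N" "n \<noteq> \<zero>\<^bsub>R\<^esub>" by blast
      have ne: "n \<odot>\<^bsub>M\<^esub> e \<noteq> \<zero>\<^bsub>M\<^esub>" using J_eqI[OF e _ z] n NJ smult_l_zero[OF e'] by auto
      have "x \<in> N" if x: "x \<in> J e" for x
      proof -
        obtain r where r: "r \<in> carrier R" "(r \<otimes>\<^bsub>R\<^esub> n) \<odot>\<^bsub>M\<^esub> e = x \<odot>\<^bsub>M\<^esub> e"
          using J_transitive[OF e subsetD[OF NJ n(1)] ne smult_closed[OF J_carrier[OF x] e']] .
        hence "r \<otimes>\<^bsub>R\<^esub> n = x"
          by (intro J_eqI[OF e _ x] J_mult[OF r(1) subsetD[OF NJ n(1)]])
        thus ?thesis using N.smult_closed[OF r(1) n(1)] by (simp add: A)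
      qed
      thus ?thesis using NJ by auto
    qed
  qed
  with \<open>submodule (J e) R ?A\<close> show ?thesis by (simp add: minimal_left_ideal_def)
qed

text \<open>A nonzero two-sided ideal contains, for each \<open>e\<close> in \<open>E\<close>, an
  element that fixes \<open>e\<close> and kills the rest of \<open>E\<close>. The sum of these acts
  on \<open>E\<close> like one, hence equals one.\<close>

lemma ideal_eq:
  assumes "ideal K R"
  shows "K = {\<zero>\<^bsub>R\<^esub>} \<or> K = carrier R"
proof (rule disjCI)
  interpret K: ideal K R by fact
  assume "K \<noteq> carrier R"
  show "K = {\<zero>\<^bsub>R\<^esub>}"
  proof (rule ccontr)
    assume "K \<noteq> {\<zero>\<^bsub>R\<^esub>}"
    then obtain k where k: "k \<in> K" "k \<noteq> \<zero>\<^bsub>R\<^esub>" using K.zero_closed by blast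
    obtain e0 where e0: "e0 \<in> E" "k \<odot>\<^bsub>M\<^esub> e0 \<noteq> \<zero>\<^bsub>M\<^esub>"
      using annihilator_E[of k] k K.Icarr by blast
    have proj: "\<exists>a\<in>K. a \<in> J e \<and> a \<odot>\<^bsub>M\<^esub> e = e" if e: "e \<in> E" for e
    proof -
      have e': "e \<in> carrier M" "e0 \<in> carrier M" using e e0 E_carrier by auto
      obtain j where j: "j \<in> J e" "j \<odot>\<^bsub>M\<^esub> e \<noteq> \<zero>\<^bsub>M\<^esub>" using J_nonzero[OF e] .
      obtain r where r: "r \<in> carrier R" "(r \<otimes>\<^bsub>R\<^esub> j) \<odot>\<^bsub>M\<^esub> e = e0"
        using J_transitive[OF e j e'(2)] .
      \<comment> \<open>The factor on the right carries \<open>e\<close> to \<open>e0\<close>, where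
        \<open>k\<close> does not vanish. Being two-sided, \<open>K\<close> contains
        \<open>i\<close>, and \<open>J e\<close> contains it as a left ideal.\<close>
      define i where "i = k \<otimes>\<^bsub>R\<^esub> (r \<otimes>\<^bsub>R\<^esub> j)"
      have rj: "r \<otimes>\<^bsub>R\<^esub> j \<in> J e" by (rule J_mult[OF r(1) j(1)])
      have i: "i \<in> K" "i \<in> J e"
        unfolding i_def
        using K.I_r_closed[OF k(1) J_carrier[OF rj]] J_mult[OF K.Icarr[OF k(1)] rj] by blast+
      have "i \<odot>\<^bsub>M\<^esub> e = k \<odot>\<^bsub>M\<^esub> e0"
        unfolding i_def using smult_assoc[OF K.Icarr[OF k(1)] J_carrier[OF rj] e'(1)] r(2) by simp
      hence "i \<odot>\<^bsub>M\<^esub> e \<noteq> \<zero>\<^bsub>M\<^esub>" using e0 by simp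
      then obtain s where "s \<in> carrier R" "(s \<otimes>\<^bsub>R\<^esub> i) \<odot>\<^bsub>M\<^esub> e = e"
        using J_transitive[OF e i(2) _ e'(1)] by metis
      thus ?thesis using K.I_l_closed[OF i(1)] J_mult[OF _ i(2)] by blast
    qed
    have "\<exists>a\<in>K. (\<forall>e\<in>F. a \<odot>\<^bsub>M\<^esub> e = e) \<and> (\<forall>e\<in>E - F. a \<odot>\<^bsub>M\<^esub> e = \<zero>\<^bsub>M\<^esub>)"
      if "finite F" "F \<subseteq> E" for F
      using that
    proof (induction F rule: finite_induct)
      case empty
      thus ?case using E_carrier K.zero_closed
        by (intro bexI[of _ "\<zero>\<^bsub>R\<^esub>"]) (auto simp: smult_l_zero)
    next
      case (insert e F)
      then obtain a where a: "a \<in> K" "\<forall>e\<in>F. a \<odot>\<^bsub>M\<^esub> e = e" "\<forall>e\<in>E - F. a \<odot>\<^bsub>M\<^esub> e = \<zero>\<^bsub>M\<^esub>" by auto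
      obtain b where b: "b \<in> K" "b \<in> J e" "b \<odot>\<^bsub>M\<^esub> e = e" using proj[of e] insert.prems by auto
      have "a \<in> carrier R" "b \<in> carrier R" using a b K.Icarr by auto
      moreover have "b \<odot>\<^bsub>M\<^esub> f = \<zero>\<^bsub>M\<^esub>" if "f \<in> F" for f
        using b(2) insert.hyps insert.prems that by (auto simp: J_def)
      ultimately show ?case using a b insert.hyps insert.prems E_carrier
        by (intro bexI[of _ "a \<oplus>\<^bsub>R\<^esub> b"])
          (auto simp: smult_l_distr J_def subset_iff)
    qed
    from this[OF finite_E order_refl] obtain a where a: "a \<in> K" "\<forall>e\<in>E. a \<odot>\<^bsub>M\<^esub> e = e" by auto
    have ac: "a \<in> carrier R" using a K.Icarr by auto
    have "\<one>\<^bsub>R\<^esub> \<ominus>\<^bsub>R\<^esub> a = \<zero>\<^bsub>R\<^esub>"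
      using ac a E_carrier
      by (intro annihilator_E smult_l_diff_eq_zero) (auto simp: smult_one subset_iff)
    hence "\<one>\<^bsub>R\<^esub> = a" by (rule R.diff_eq_zeroD[OF R.one_closed ac])
    hence "K = carrier R" using a K.one_imp_carrier by simp
    thus False using \<open>K \<noteq> carrier R\<close> by simp
  qed
qed

end

text \<open>Replacing \<open>E\<close> by a set of least cardinality with zero annihilator gives the
  minimality required in \<open>finitely_faithful\<close>. This set is nonempty, since otherwise one
  would be zero.\<close>

lemma simple_ring_minimal_left_idealI:
  fixes M :: "('a, 'b, 'm) module_scheme"
  assumes "simple_module R M" "finite E" "E \<subseteq> carrier M"
    and "\<And>a. \<lbrakk>a \<in> carrier R; \<And>e. e \<in> E \<Longrightarrow> a \<odot>\<^bsub>M\<^esub> e = \<zero>\<^bsub>M\<^esub>\<rbrakk> \<Longrightarrow> a = \<zero>\<^bsub>R\<^esub>"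
  shows "simple_ring R \<and> (\<exists>L. minimal_left_ideal L R)"
proof -
  interpret simple_left_module R M
    using assms(1) by (intro simple_left_module.intro simple_left_module_axioms.intro)
      (auto simp: simple_module_def)
  define Q where "Q F \<longleftrightarrow> F \<subseteq> carrier M \<and>
     (\<forall>a\<in>carrier R. (\<forall>e\<in>F. a \<odot>\<^bsub>M\<^esub> e = \<zero>\<^bsub>M\<^esub>) \<longrightarrow> a = \<zero>\<^bsub>R\<^esub>)" for F
  have "finite E \<and> Q E" using assms(2-4) by (auto simp: Q_def)
  then obtain F where F: "finite F" "Q F" "\<And>F'. finite F' \<Longrightarrow> Q F' \<Longrightarrow> card F \<le> card F'"
    using ex_has_least_nat[of "\<lambda>F. finite F \<and> Q F" E card] by blast
  interpret finitely_faithful R M F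
  proof
    fix F' assume "F' \<subset> F"
    hence "\<not> Q F'" using F(1) F(3)[of F'] by (meson finite_subset leD psubset_card_mono psubset_imp_subset)
    thus "\<exists>a\<in>carrier R. a \<noteq> \<zero>\<^bsub>R\<^esub> \<and> (\<forall>e\<in>F'. a \<odot>\<^bsub>M\<^esub> e = \<zero>\<^bsub>M\<^esub>)"
      using F(2) \<open>F' \<subset> F\<close> unfolding Q_def by blast
  qed (use F in \<open>auto simp: Q_def\<close>)
  have "F \<noteq> {}" using annihilator_E[of "\<one>\<^bsub>R\<^esub>"] one_not_zero by auto
  then obtain e where "e \<in> F" by auto
  moreover have "simple_ring R"
    unfolding simple_ring_def
  proof (intro conjI allI impI R.ring_axioms ideal_eq)
    show "\<exists>a\<in>carrier R. \<exists>b\<in>carrier R. a \<otimes>\<^bsub>R\<^esub> b \<noteq> \<zero>\<^bsub>R\<^esub>"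
      using one_not_zero by (metis R.one_closed R.l_one)
  qed
  ultimately show ?thesis using minimal_left_ideal_J by blast
qed

subsection \<open>Polynomials in a linear operator\<close>

locale vector_space_operator = vector_space scale
  for scale :: "'k :: alg_closed_field \<Rightarrow> 'v :: ab_group_add \<Rightarrow> 'v" (infixr \<open>*s\<close> 75) +
  fixes T :: "'v \<Rightarrow> 'v"
  assumes T_add: "T (x + y) = T x + T y" and T_scale: "T (c *s x) = c *s T x"
begin

text \<open>Horner's scheme for the value at \<open>x\<close> of the operator p(T).\<close>

definition ev :: "'k poly \<Rightarrow> 'v \<Rightarrow> 'v" where
  "ev p x = fold_coeffs (\<lambda>a y. a *s x + T y) p 0"

lemma T_zero [simp]: "T 0 = 0"
  using T_add[of 0 0] by simp

lemma ev_0 [simp]: "ev 0 x = 0"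
  by (simp add: ev_def)

lemma ev_pCons [simp]: "ev (pCons a p) x = a *s x + T (ev p x)"
  by (cases "a = 0 \<and> p = 0") (auto simp: ev_def)

lemma ev_add: "ev (p + q) x = ev p x + ev q x"
  by (induction p q rule: poly_induct2) (simp_all add: T_add scale_left_distrib ac_simps)

lemma ev_smult: "ev (smult c p) x = c *s ev p x"
  by (induction p) (simp_all add: T_scale scale_right_distrib)

lemma ev_sum: "ev (sum f A) x = (\<Sum>a\<in>A. ev (f a) x)"
  by (induction A rule: infinite_finite_induct) (simp_all add: ev_add)

lemma ev_mult: "ev (p * q) x = ev p (ev q x)"
  by (induction p) (simp_all add: ev_add ev_smult)

lemma ev_add_right: "ev p (x + y) = ev p x + ev p y"
  by (induction p) (simp_all add: T_add scale_right_distrib ac_simps)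

lemma ev_scale_right: "ev p (c *s x) = c *s ev p x"
  by (induction p) (simp_all add: T_scale scale_right_distrib scale_left_commute)

lemma ev_zero_right [simp]: "ev p 0 = 0"
  by (induction p) simp_all

lemma ev_sum_right: "ev p (sum f A) = (\<Sum>a\<in>A. ev p (f a))"
  by (induction A rule: infinite_finite_induct) (simp_all add: ev_add_right)

lemma ev_invariant:
  assumes "subspace P" "\<And>x. x \<in> P \<Longrightarrow> T x \<in> P" "x \<in> P"
  shows "ev p x \<in> P"
  by (induction p) (auto simp: assms subspace_0 subspace_add subspace_scale)

lemma ev_linear: "ev [:- \<mu>, 1:] x = T x - \<mu> *s x"
  by simp

text \<open>Over an algebraically closed field every polynomial in \<open>T\<close> is a product of shifts of \<open>T\<close>,
  so injectivity of the shifts modulo \<open>P\<close> passes to all nonzero polynomials.\<close>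

lemma ev_injective:
  assumes "subspace P" "subspace A" "\<And>x. x \<in> A \<Longrightarrow> T x \<in> A"
    and inj: "\<And>\<mu> x. x \<in> A \<Longrightarrow> T x - \<mu> *s x \<in> P \<Longrightarrow> x \<in> P"
    and "p \<noteq> 0" "x \<in> A" "ev p x \<in> P"
  shows "x \<in> P"
  using assms(5-)
proof (induction "degree p" arbitrary: p)
  case 0
  then obtain a where a: "p = [:a:]" "a \<noteq> 0" by (metis degree_eq_zeroE pCons_0_0)
  thus ?case using 0 subspace_scale[OF assms(1), of "a *s x" "inverse a"] by simp
next
  case (Suc n)
  obtain \<mu> where "poly p \<mu> = 0" using alg_closed_imp_poly_has_root[of p] Suc.hyps(2) by auto
  then obtain q where q: "p = [:- \<mu>, 1:] * q" by (auto simp: poly_eq_0_iff_dvd)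
  hence "q \<noteq> 0" using Suc by auto
  hence "n = degree q" using Suc.hyps(2) q by (simp add: degree_mult_eq del: mult_pCons_left)
  have "T (ev q x) - \<mu> *s ev q x \<in> P" using Suc.prems(3) unfolding q ev_mult ev_linear .
  hence "ev q x \<in> P" using inj ev_invariant[OF assms(2,3) Suc.prems(2)] by blast
  thus ?case using Suc.hyps(1)[of q] \<open>n = degree q\<close> \<open>q \<noteq> 0\<close> Suc.prems(2) by blast
qed

text \<open>Modulo \<open>P\<close>, the vector \<open>v \<mu>\<close> is the resolvent (T -
  \<mu>)^(-1) applied to \<open>m\<close>. Clearing denominators turns a linear relation into q(T) m
  \<in> P for a polynomial \<open>q\<close>, nonzero if some coefficient is;
  \<open>ev_injective\<close> then gives m \<in> P.\<close>

lemma resolvents_independent: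
  assumes "subspace P" "\<And>x. x \<in> P \<Longrightarrow> T x \<in> P" "subspace A" "\<And>x. x \<in> A \<Longrightarrow> T x \<in> A"
    and inj: "\<And>\<mu> x. x \<in> A \<Longrightarrow> T x - \<mu> *s x \<in> P \<Longrightarrow> x \<in> P"
    and m: "m \<in> A" "m \<notin> P"
    and v: "\<And>\<mu>. T (v \<mu>) - \<mu> *s v \<mu> - m \<in> P"
    and S: "finite S" "(\<Sum>\<mu>\<in>S. c \<mu> *s v \<mu>) = 0" "\<nu> \<in> S"
  shows "c \<nu> = 0"
proof (rule ccontr)
  assume c: "c \<nu> \<noteq> 0"
  \<comment> \<open>\<open>\<pi> S\<close> is the common denominator, and \<open>q\<close> below is
    the numerator of the sum of the partial fractions c \<mu> / (X - \<mu>).\<close>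
  define \<pi> where "\<pi> S = (\<Prod>\<mu>\<in>S. [:- \<mu>, 1:])" for S :: "'k set"
  define q where "q = (\<Sum>\<mu>\<in>S. smult (c \<mu>) (\<pi> (S - {\<mu>})))"
  have *: "ev (\<pi> S) (v \<mu>) - ev (\<pi> (S - {\<mu>})) m \<in> P" if "\<mu> \<in> S" for \<mu>
  proof -
    have "\<pi> S = \<pi> (S - {\<mu>}) * [:- \<mu>, 1:]"
      unfolding \<pi>_def using S(1) that by (subst prod.remove[of S \<mu>]) (simp_all add: mult.commute)
    hence "ev (\<pi> S) (v \<mu>) = ev (\<pi> (S - {\<mu>})) (m + (T (v \<mu>) - \<mu> *s v \<mu> - m))"
      by (simp add: ev_mult del: mult_pCons_left mult_pCons_right)
    also have "\<dots> = ev (\<pi> (S - {\<mu>})) m + ev (\<pi> (S - {\<mu>})) (T (v \<mu>) - \<mu> *s v \<mu> - m)"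
      by (rule ev_add_right)
    finally show ?thesis using ev_invariant[OF assms(1,2) v] by simp
  qed
  have "(\<Sum>\<mu>\<in>S. c \<mu> *s (ev (\<pi> S) (v \<mu>) - ev (\<pi> (S - {\<mu>})) m)) \<in> P"
    using * assms(1) by (intro subspace_sum subspace_scale)
  also have "(\<Sum>\<mu>\<in>S. c \<mu> *s (ev (\<pi> S) (v \<mu>) - ev (\<pi> (S - {\<mu>})) m)) =
      ev (\<pi> S) (\<Sum>\<mu>\<in>S. c \<mu> *s v \<mu>) - ev q m"
    unfolding q_def ev_sum ev_sum_right ev_smult ev_scale_right
    by (simp add: scale_right_diff_distrib sum_subtractf)
  finally have "ev q m \<in> P" using S(2) subspace_neg[OF assms(1)] by fastforce
  \<comment> \<open>At \<nu> only the summand with \<mu> = \<nu> survives; all others contain the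
    factor X - \<nu>.\<close>
  moreover have "poly q \<nu> = c \<nu> * (\<Prod>\<mu>\<in>S - {\<nu>}. \<nu> - \<mu>)"
  proof -
    have "poly (\<pi> (S - {\<mu>})) \<nu> = 0" if "\<mu> \<in> S - {\<nu>}" for \<mu>
      using that S by (auto simp: \<pi>_def poly_prod)
    hence "poly q \<nu> = c \<nu> * poly (\<pi> (S - {\<nu>})) \<nu>"
      unfolding q_def poly_sum poly_smult using S by (subst sum.remove[of S \<nu>]) auto
    thus ?thesis by (simp add: \<pi>_def poly_prod)
  qed
  hence "q \<noteq> 0" using c S(1) by auto
  ultimately have "m \<in> P"
    using m(1) assms(1,3,4) inj by (intro ev_injective[of P A q m])
  with m(2) show False by simp
qed

end

subsection \<open>Finitely supported functions\<close>

definition fscale :: "complex \<Rightarrow> ('g \<Rightarrow> complex) \<Rightarrow> 'g \<Rightarrow> complex" where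
  "fscale c f = (\<lambda>x. c * f x)"

lemma fscale_apply [simp]: "fscale c f x = c * f x"
  by (simp add: fscale_def)

text \<open>The ambient space consists of all functions on the type; the group algebra enters later
  as its subspace \<open>FS\<close>.\<close>

interpretation fun_vs: vector_space fscale
  by unfold_locales (simp_all add: fun_eq_iff algebra_simps)

lemma sum_fun_apply: "sum F A x = (\<Sum>a\<in>A. F a x)" for F :: "'a \<Rightarrow> 'g \<Rightarrow> 'k :: comm_monoid_add"
  by (induction A rule: infinite_finite_induct) auto

definition point :: "'g \<Rightarrow> 'g \<Rightarrow> complex" where
  "point g = (\<lambda>x. if x = g then 1 else 0)"

lemma point_expansion:
  assumes "finite S" "{x. f x \<noteq> 0} \<subseteq> S"
  shows "f = (\<Sum>g\<in>S. fscale (f g) (point g))"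
proof
  fix x
  have "(\<Sum>g\<in>S. f g * point g x) = (\<Sum>g\<in>S. if x = g then f g else 0)"
    by (intro sum.cong) (auto simp: point_def)
  also have "\<dots> = f x" using assms by auto
  finally show "f x = (\<Sum>g\<in>S. fscale (f g) (point g)) x" by (simp add: sum_fun_apply)
qed

text \<open>A countable \<open>X\<close> has only countably many finite subsets, so one of them,
  \<open>F\<close>, is the support of infinitely many \<open>v \<mu>\<close>. These are distinct
  vectors in a space spanned by finitely many points.\<close>

lemma uncountable_family_dependent:
  fixes v :: "complex \<Rightarrow> 'g \<Rightarrow> complex"
  assumes "countable X" "\<And>\<mu>. finite {x. v \<mu> x \<noteq> 0}" "\<And>\<mu>. {x. v \<mu> x \<noteq> 0} \<subseteq> X" "inj v"
  obtains S c \<nu> where "finite S" "(\<Sum>\<mu>\<in>S. fscale (c \<mu>) (v \<mu>)) = 0" "\<nu> \<in> S" "c \<nu> \<noteq> 0"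
proof -
  let ?X = "{F. finite F \<and> F \<subseteq> X}"
  have UN: "UNIV = (\<Union>F\<in>?X. {\<mu>. {x. v \<mu> x \<noteq> 0} = F})" using assms(2,3) by auto
  have "\<exists>F\<in>?X. infinite {\<mu>. {x. v \<mu> x \<noteq> 0} = F}"
  proof (rule ccontr)
    assume "\<not> ?thesis"
    hence "countable (\<Union>F\<in>?X. {\<mu>. {x. v \<mu> x \<noteq> 0} = F})"
      by (intro countable_UN countable_Collect_finite_subset assms(1)) (auto intro: countable_finite)
    thus False using UN uncountable_UNIV_complex by simp
  qed
  then obtain F where F: "finite F" "infinite {\<mu>. {x. v \<mu> x \<noteq> 0} = F}" by auto
  let ?V = "v ` {\<mu>. {x. v \<mu> x \<noteq> 0} = F}"
  have "?V \<subseteq> fun_vs.span (point ` F)"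
  proof
    fix w assume "w \<in> ?V"
    then obtain \<mu> where \<mu>: "w = v \<mu>" "{x. v \<mu> x \<noteq> 0} = F" by auto
    hence "v \<mu> = (\<Sum>g\<in>F. fscale (v \<mu> g) (point g))" using F(1) by (intro point_expansion) auto
    also have "\<dots> \<in> fun_vs.span (point ` F)"
      by (intro fun_vs.span_sum fun_vs.span_scale fun_vs.span_base imageI)
    finally show "w \<in> fun_vs.span (point ` F)" using \<mu> by simp
  qed
  moreover have "infinite ?V" using F(2) assms(4) by (meson finite_imageD inj_on_subset subset_UNIV)
  ultimately have "fun_vs.dependent ?V"
    using fun_vs.independent_span_bound[of "point ` F" ?V] F(1) by auto
  then obtain t u w where t: "finite t" "t \<subseteq> ?V" "(\<Sum>w\<in>t. fscale (u w) w) = 0" "w \<in> t" "u w \<noteq> 0"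
    unfolding fun_vs.dependent_explicit by auto
  \<comment> \<open>The relation among the vectors in \<open>t\<close> is pulled back along the
    injective \<open>v\<close> to one indexed by complex numbers.\<close>
  obtain S where S: "t = v ` S" "finite S" using t(1,2) finite_subset_image by metis
  obtain \<nu> where "\<nu> \<in> S" "w = v \<nu>" using t(4) S(1) by auto
  thus thesis using that[of S "u \<circ> v" \<nu>] t S sum.reindex[of v S "\<lambda>w. fscale (u w) w"] inj_on_subset[OF assms(4)]
    by auto
qed

subsection \<open>Invariant subspaces of the group algebra\<close>

context group
begin

abbreviation FS :: "('a \<Rightarrow> complex) set" where
  "FS \<equiv> carrier (group_algebra G)"

text \<open>Left multiplication of \<open>f\<close> by the group element \<open>g\<close>. The value
  0 off the carrier keeps supports inside the group, where \<open>inv g \<otimes> x\<close> is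
  meaningful.\<close>

definition tr :: "'a \<Rightarrow> ('a \<Rightarrow> complex) \<Rightarrow> 'a \<Rightarrow> complex" where
  "tr g f = (\<lambda>x. if x \<in> carrier G then f (inv g \<otimes> x) else 0)"

lemma FS_iff: "f \<in> FS \<longleftrightarrow> finite {x. f x \<noteq> 0} \<and> {x. f x \<noteq> 0} \<subseteq> carrier G"
  by (simp add: group_algebra_def)

lemma group_algebra_add: "f \<oplus>\<^bsub>group_algebra G\<^esub> k = f + k"
  and group_algebra_zero: "\<zero>\<^bsub>group_algebra G\<^esub> = 0"
  by (simp_all add: group_algebra_def plus_fun_def zero_fun_def)

lemma subspace_FS: "fun_vs.subspace FS"
proof (rule fun_vs.subspaceI)
  fix f k assume "f \<in> FS" "k \<in> FS"
  moreover have "{x. (f + k) x \<noteq> 0} \<subseteq> {x. f x \<noteq> 0} \<union> {x. k x \<noteq> 0}" by auto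
  ultimately show "f + k \<in> FS" unfolding FS_iff by (meson finite_UnI finite_subset subset_trans Un_least)
next
  fix c f assume "f \<in> FS"
  moreover have "{x. fscale c f x \<noteq> 0} \<subseteq> {x. f x \<noteq> 0}" by auto
  ultimately show "fscale c f \<in> FS" unfolding FS_iff by (meson finite_subset subset_trans)
qed (simp add: FS_iff)

lemma point_FS: "g \<in> carrier G \<Longrightarrow> point g \<in> FS"
  by (simp add: FS_iff point_def)

lemma tr_add: "tr g (f + k) = tr g f + tr g k"
  and tr_scale: "tr g (fscale c f) = fscale c (tr g f)"
  and tr_diff: "tr g (f - k) = tr g f - tr g k"
  and tr_zero: "tr g 0 = 0"
  by (simp_all add: tr_def fun_eq_iff)

lemma tr_tr:
  assumes "g \<in> carrier G" "h \<in> carrier G"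
  shows "tr g (tr h f) = tr (g \<otimes> h) f"
  using assms by (auto simp: tr_def fun_eq_iff inv_mult_group m_assoc)

lemma tr_one: "f \<in> FS \<Longrightarrow> tr \<one> f = f"
  by (auto simp: tr_def fun_eq_iff FS_iff)

lemma tr_point:
  assumes "g \<in> carrier G" "h \<in> carrier G"
  shows "tr g (point h) = point (g \<otimes> h)"
proof
  fix x
  have "inv g \<otimes> x = h \<longleftrightarrow> x = g \<otimes> h" if "x \<in> carrier G"
    using assms that by (metis inv_solve_left m_closed)
  thus "tr g (point h) x = point (g \<otimes> h) x" using assms by (auto simp: tr_def point_def)
qed

lemma tr_FS:
  assumes "g \<in> carrier G" "f \<in> FS"
  shows "tr g f \<in> FS"
proof -
  have "{x. tr g f x \<noteq> 0} \<subseteq> (\<otimes>) g ` {x. f x \<noteq> 0}"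
  proof
    fix x assume "x \<in> {x. tr g f x \<noteq> 0}"
    hence "x \<in> carrier G" "f (inv g \<otimes> x) \<noteq> 0" by (auto simp: tr_def split: if_splits)
    moreover have "x = g \<otimes> (inv g \<otimes> x)"
      using assms(1) \<open>x \<in> carrier G\<close> by (simp add: m_assoc[symmetric])
    ultimately show "x \<in> (\<otimes>) g ` {x. f x \<noteq> 0}" by blast
  qed
  moreover have "{x. tr g f x \<noteq> 0} \<subseteq> carrier G" by (auto simp: tr_def)
  ultimately show ?thesis using assms(2) unfolding FS_iff by (meson finite_imageI finite_subset)
qed

text \<open>Expresses multiplication through translations, so that subspaces closed under
  translation are left ideals.\<close>

lemma group_algebra_mult_tr:
  assumes "f \<in> FS" "k \<in> FS"
  shows "f \<otimes>\<^bsub>group_algebra G\<^esub> k = (\<Sum>y | f y \<noteq> 0. fscale (f y) (tr y k))"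
proof
  fix x
  have fin: "finite {y. f y \<noteq> 0}" "finite {z. k z \<noteq> 0}" using assms FS_iff by auto
  have "(f \<otimes>\<^bsub>group_algebra G\<^esub> k) x =
      (\<Sum>y | f y \<noteq> 0. \<Sum>z | k z \<noteq> 0. if y \<otimes> z = x then f y * k z else 0)"
    by (rule group_algebra_mult_eq[OF fin(1) order_refl fin(2) order_refl])
  also have "\<dots> = (\<Sum>y | f y \<noteq> 0. f y * tr y k x)"
  proof (rule sum.cong[OF refl])
    fix y assume "y \<in> {y. f y \<noteq> 0}"
    hence y: "y \<in> carrier G" using assms(1) FS_iff by auto
    \<comment> \<open>For fixed \<open>x\<close> and \<open>y\<close> at most one \<open>z\<close>
      contributes to the inner sum, namely the quotient of \<open>x\<close> by \<open>y\<close> on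
      the left.\<close>
    have eq: "y \<otimes> z = x \<longleftrightarrow> x \<in> carrier G \<and> z = inv y \<otimes> x" if "k z \<noteq> 0" for z
    proof -
      have "z \<in> carrier G" using assms(2) FS_iff that by auto
      thus ?thesis using y by (metis inv_solve_left m_closed)
    qed
    have "(\<Sum>z | k z \<noteq> 0. if y \<otimes> z = x then f y * k z else 0) =
        (\<Sum>z | k z \<noteq> 0. if z = inv y \<otimes> x then if x \<in> carrier G then f y * k z else 0 else 0)"
      by (intro sum.cong refl) (auto simp: eq)
    also have "\<dots> = f y * tr y k x"
      using fin(2) by (simp add: tr_def)
    finally show "(\<Sum>z | k z \<noteq> 0. if y \<otimes> z = x then f y * k z else 0) = f y * tr y k x" .
  qed
  finally show "(f \<otimes>\<^bsub>group_algebra G\<^esub> k) x = (\<Sum>y | f y \<noteq> 0. fscale (f y) (tr y k)) x"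
    by (simp add: sum_fun_apply)
qed

text \<open>Both scalars (g = 1) and translations (c = 1) are multiplications by ring elements; this
  makes left ideals translation-invariant subspaces. For c = 0 the left factor has empty
  support.\<close>

lemma scaled_point_mult:
  assumes "g \<in> carrier G" "k \<in> FS"
  shows "fscale c (point g) \<otimes>\<^bsub>group_algebra G\<^esub> k = fscale c (tr g k)"
proof (cases "c = 0")
  case False
  hence "{y. fscale c (point g) y \<noteq> 0} = {g}" by (auto simp: point_def)
  thus ?thesis
    using group_algebra_mult_tr[OF fun_vs.subspace_scale[OF subspace_FS point_FS[OF assms(1)]] assms(2), of c]
    by (simp add: point_def)
next
  case True
  thus ?thesis
    using group_algebra_mult_tr[OF fun_vs.subspace_scale[OF subspace_FS point_FS[OF assms(1)]] assms(2), of c]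
    by simp
qed

lemma mult_add_right:
  "a \<in> FS \<Longrightarrow> x \<in> FS \<Longrightarrow> y \<in> FS \<Longrightarrow>
    a \<otimes>\<^bsub>group_algebra G\<^esub> (x + y) = a \<otimes>\<^bsub>group_algebra G\<^esub> x + a \<otimes>\<^bsub>group_algebra G\<^esub> y"
  using fun_vs.subspace_add[OF subspace_FS, of x y]
  by (simp add: group_algebra_mult_tr tr_add fun_vs.scale_right_distrib sum.distrib)

lemma mult_scale_right:
  "a \<in> FS \<Longrightarrow> x \<in> FS \<Longrightarrow>
    a \<otimes>\<^bsub>group_algebra G\<^esub> fscale c x = fscale c (a \<otimes>\<^bsub>group_algebra G\<^esub> x)"
  using fun_vs.subspace_scale[OF subspace_FS, of x c]
  by (simp add: group_algebra_mult_tr tr_scale fun_vs.scale_sum_right mult.commute)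

text \<open>For \<open>S\<close> the whole group these are the left ideals of the group algebra; for
  a subgroup they are its submodules over the algebra of the subgroup.\<close>

definition invariant :: "'a set \<Rightarrow> ('a \<Rightarrow> complex) set \<Rightarrow> bool" where
  "invariant S W \<longleftrightarrow> fun_vs.subspace W \<and> W \<subseteq> FS \<and> (\<forall>g\<in>S. \<forall>f\<in>W. tr g f \<in> W)"

definition max_invariant :: "'a set \<Rightarrow> ('a \<Rightarrow> complex) set \<Rightarrow> bool" where
  "max_invariant S P \<longleftrightarrow> invariant S P \<and> P \<noteq> FS \<and>
     (\<forall>W. invariant S W \<longrightarrow> P \<subseteq> W \<longrightarrow> W = P \<or> W = FS)"

lemma max_invariantD:
  assumes "max_invariant S P"
  shows "fun_vs.subspace P" "P \<subseteq> FS" "\<And>g x. g \<in> S \<Longrightarrow> x \<in> P \<Longrightarrow> tr g x \<in> P" "P \<noteq> FS"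
    "\<And>W. invariant S W \<Longrightarrow> P \<subseteq> W \<Longrightarrow> W \<noteq> P \<Longrightarrow> W = FS"
  using assms by (auto simp: max_invariant_def invariant_def)

lemma invariant_mult:
  assumes "invariant (carrier G) W" "a \<in> FS" "w \<in> W"
  shows "a \<otimes>\<^bsub>group_algebra G\<^esub> w \<in> W"
proof -
  have "w \<in> FS" using assms by (auto simp: invariant_def)
  thus ?thesis
    using assms unfolding group_algebra_mult_tr[OF assms(2) \<open>w \<in> FS\<close>]
    by (intro fun_vs.subspace_sum fun_vs.subspace_scale) (auto simp: invariant_def FS_iff)
qed

end

section \<open>Maximal invariant subspaces for an abelian subgroup of finite index\<close>

locale abelian_transversal = group +
  fixes H :: "'a set" and S :: "'a set"
  assumes H: "subgroup H G" and H_comm: "\<lbrakk>h \<in> H; k \<in> H\<rbrakk> \<Longrightarrow> h \<otimes> k = k \<otimes> h"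
    and finite_S: "finite S" and S_carrier: "S \<subseteq> carrier G"
    and cover: "g \<in> carrier G \<Longrightarrow> \<exists>h\<in>H. \<exists>s\<in>S. g = h \<otimes> s"
    and countable_carrier: "countable (carrier G)"
begin

lemma H_carrier: "h \<in> H \<Longrightarrow> h \<in> carrier G"
  using subgroup.mem_carrier[OF H] .

text \<open>The points of \<open>S\<close> generate \<open>FS\<close> over \<open>H\<close>: since G
  = H S, every point is a translate by \<open>H\<close> of a point of \<open>S\<close>, and points
  span \<open>FS\<close>.\<close>

lemma invariant_eq_FS:
  assumes "invariant H W" "point ` S \<subseteq> W"
  shows "W = FS"
proof
  show "FS \<subseteq> W"
  proof
    fix f assume f: "f \<in> FS"
    have "point g \<in> W" if "f g \<noteq> 0" for g
    proof -
      have "g \<in> carrier G" using f that by (auto simp: FS_iff)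
      then obtain h s where "h \<in> H" "s \<in> S" "g = h \<otimes> s" using cover by blast
      moreover hence "tr h (point s) = point g" using H_carrier S_carrier by (auto simp: tr_point)
      ultimately show ?thesis using assms by (force simp: invariant_def)
    qed
    hence "(\<Sum>g | f g \<noteq> 0. fscale (f g) (point g)) \<in> W"
      using assms(1) by (intro fun_vs.subspace_sum fun_vs.subspace_scale) (auto simp: invariant_def)
    thus "f \<in> W" using point_expansion[of "{g. f g \<noteq> 0}" f] f by (simp add: FS_iff)
  qed
qed (use assms in \<open>auto simp: invariant_def\<close>)

text \<open>\<open>FS\<close> is finitely generated over \<open>H\<close>, so unions of chains of proper invariant subspaces
  are proper.\<close>

lemma max_invariant_exists:
  assumes "invariant H L" "L \<noteq> FS"
  obtains P where "max_invariant H P" "L \<subseteq> P"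
proof -
  \<comment> \<open>For invariant subspaces, missing some point of \<open>S\<close> is equivalent to
    being proper. As a condition on a finite set it survives unions of nonempty chains.\<close>
  let ?C = "{P. invariant H P \<and> L \<subseteq> P \<and> \<not> point ` S \<subseteq> P}"
  have "\<exists>P\<in>?C. \<forall>X\<in>?C. P \<subseteq> X \<longrightarrow> X = P"
  proof (rule subset_Zorn_nonempty)
    show "?C \<noteq> {}" using assms invariant_eq_FS by auto
  next
    fix \<C> assume ne: "\<C> \<noteq> {}" and chain: "subset.chain ?C \<C>"
    have C: "invariant H P" "L \<subseteq> P" "\<not> point ` S \<subseteq> P" if "P \<in> \<C>" for P
      using chain that by (auto simp: subset.chain_def)
    have "invariant H (\<Union>\<C>)"
      unfolding invariant_def
    proof (intro conjI fun_vs.subspaceI)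
      obtain P where "P \<in> \<C>" using ne by blast
      thus "0 \<in> \<Union>\<C>" using C(1)[of P] fun_vs.subspace_0[of P] by (auto simp: invariant_def)
    next
      fix x y assume "x \<in> \<Union>\<C>" "y \<in> \<Union>\<C>"
      then obtain X Y where "X \<in> \<C>" "Y \<in> \<C>" "x \<in> X" "y \<in> Y" by blast
      moreover hence "X \<subseteq> Y \<or> Y \<subseteq> X" using chain by (auto simp: subset.chain_def)
      ultimately obtain Z where "Z \<in> \<C>" "x \<in> Z" "y \<in> Z" by blast
      moreover hence "x + y \<in> Z"
        using C(1)[of Z] fun_vs.subspace_add[of Z x y] by (auto simp: invariant_def)
      ultimately show "x + y \<in> \<Union>\<C>" by blast
    next
      fix c x assume "x \<in> \<Union>\<C>"
      thus "fscale c x \<in> \<Union>\<C>" using C(1) by (auto simp: invariant_def intro: fun_vs.subspace_scale)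
    next
      show "\<Union>\<C> \<subseteq> FS" using C(1) by (auto simp: invariant_def)
      show "\<forall>g\<in>H. \<forall>f\<in>\<Union>\<C>. tr g f \<in> \<Union>\<C>" using C(1) unfolding invariant_def by blast
    qed
    moreover have "\<not> point ` S \<subseteq> \<Union>\<C>"
      using finite_subset_Union_chain[of "point ` S" \<C> ?C] finite_S ne chain C(3) by blast
    ultimately show "\<Union>\<C> \<in> ?C" using ne C(2) by blast
  qed
  then obtain P where "P \<in> ?C" and max: "\<forall>X\<in>?C. P \<subseteq> X \<longrightarrow> X = P" ..
  hence P: "invariant H P" "L \<subseteq> P" "\<not> point ` S \<subseteq> P" by simp_all
  have "point ` S \<subseteq> FS" using S_carrier point_FS by auto
  have "max_invariant H P"
    unfolding max_invariant_def
  proof (intro conjI allI impI P(1))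
    show "P \<noteq> FS" using P(3) \<open>point ` S \<subseteq> FS\<close> by blast
    fix W assume W: "invariant H W" "P \<subseteq> W"
    show "W = P \<or> W = FS"
    proof (cases "point ` S \<subseteq> W")
      case True
      thus ?thesis using invariant_eq_FS W(1) by simp
    next
      case False
      hence "W \<in> ?C" using W P(2) by simp
      thus ?thesis using max W(2) by simp
    qed
  qed
  thus thesis using P(2) by (rule that)
qed

text \<open>Amitsur's argument: otherwise every \<open>tr h - \<mu>\<close> is bijective modulo \<open>P\<close>, and the resolvents
  applied to a fixed vector outside \<open>P\<close> are uncountably many independent vectors in \<open>FS\<close>, whose
  dimension is countable.\<close>

lemma scalar_action:
  assumes P: "max_invariant H P" and h: "h \<in> H"
  obtains \<mu> where "\<And>x. x \<in> FS \<Longrightarrow> tr h x - fscale \<mu> x \<in> P"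
proof (rule ccontr)
  define D where "D \<mu> x = tr h x - fscale \<mu> x" for \<mu> x
  assume "\<not> thesis"
  hence nonscalar: "\<exists>x\<in>FS. D \<mu> x \<notin> P" for \<mu> using that by (auto simp: D_def)
  note PD = max_invariantD[OF P]
  have D_FS: "D \<mu> x \<in> FS" if "x \<in> FS" for \<mu> x
    unfolding D_def using that tr_FS[OF H_carrier[OF h]]
    by (intro fun_vs.subspace_diff fun_vs.subspace_scale subspace_FS)
  have D_P: "D \<mu> x \<in> P" if "x \<in> P" for \<mu> x
    unfolding D_def using that PD(3)[OF h] by (intro fun_vs.subspace_diff fun_vs.subspace_scale PD(1))
  have D_add: "D \<mu> (x + y) = D \<mu> x + D \<mu> y" for \<mu> x y
    by (simp add: D_def tr_add fun_vs.scale_right_distrib)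
  have D_scale: "D \<mu> (fscale c x) = fscale c (D \<mu> x)" for \<mu> c x
    by (simp add: D_def tr_scale fun_vs.scale_right_diff_distrib mult.commute)
  have D_tr: "tr k (D \<mu> x) = D \<mu> (tr k x)" if "k \<in> H" for k \<mu> x
    using H_comm[OF h that] H_carrier h that by (simp add: D_def tr_diff tr_scale tr_tr)
  have D_zero: "D \<mu> 0 = 0" for \<mu> by (simp add: D_def tr_zero)
  have inj: "x \<in> P" if "x \<in> FS" "D \<mu> x \<in> P" for \<mu> x
  proof -
    \<comment> \<open>The kernel of \<open>D \<mu>\<close> modulo \<open>P\<close> is invariant
      because \<open>H\<close> is commutative, and proper because \<open>h\<close> does not act as
      the scalar \<mu>. Maximality leaves only \<open>P\<close>.\<close>
    let ?W = "{x \<in> FS. D \<mu> x \<in> P}"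
    have "invariant H ?W"
      unfolding invariant_def
      using fun_vs.subspace_0[OF subspace_FS] fun_vs.subspace_add[OF subspace_FS]
        fun_vs.subspace_scale[OF subspace_FS] fun_vs.subspace_0[OF PD(1)]
        fun_vs.subspace_add[OF PD(1)] fun_vs.subspace_scale[OF PD(1)] PD(3) H_carrier
      by (auto intro!: fun_vs.subspaceI tr_FS simp: D_zero D_add D_scale D_tr[symmetric])
    moreover have "P \<subseteq> ?W" using PD(2) D_P by auto
    moreover have "?W \<noteq> FS" using nonscalar[of \<mu>] by blast
    ultimately have "?W = P" using PD(5) by blast
    thus ?thesis using that by blast
  qed
  have surj: "\<exists>u\<in>FS. D \<mu> u - x \<in> P" if "x \<in> FS" for \<mu> x
  proof -
    \<comment> \<open>This is the image of \<open>D \<mu>\<close> enlarged by \<open>P\<close>. It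
      is again invariant, and strictly larger than \<open>P\<close> because some
      \<open>D \<mu> y\<close> lies outside \<open>P\<close>.\<close>
    let ?W = "{x \<in> FS. \<exists>u\<in>FS. D \<mu> u - x \<in> P}"
    have "invariant H ?W"
      unfolding invariant_def
    proof (intro conjI fun_vs.subspaceI ballI)
      have "D \<mu> 0 - 0 \<in> P" using fun_vs.subspace_0[OF PD(1)] by (simp add: D_zero)
      thus "0 \<in> ?W" using fun_vs.subspace_0[OF subspace_FS] by blast
    next
      fix x y assume "x \<in> ?W" "y \<in> ?W"
      then obtain u w where u: "x \<in> FS" "y \<in> FS" "u \<in> FS" "w \<in> FS" "D \<mu> u - x \<in> P" "D \<mu> w - y \<in> P"
        by blast
      hence "D \<mu> (u + w) - (x + y) \<in> P"
        using fun_vs.subspace_add[OF PD(1), of "D \<mu> u - x" "D \<mu> w - y"]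
        by (simp add: D_add algebra_simps)
      thus "x + y \<in> ?W" using u fun_vs.subspace_add[OF subspace_FS] by blast
    next
      fix c x assume "x \<in> ?W"
      then obtain u where u: "x \<in> FS" "u \<in> FS" "D \<mu> u - x \<in> P" by blast
      hence "D \<mu> (fscale c u) - fscale c x \<in> P"
        using fun_vs.subspace_scale[OF PD(1), of "D \<mu> u - x" c]
        by (simp add: D_scale fun_vs.scale_right_diff_distrib)
      thus "fscale c x \<in> ?W" using u fun_vs.subspace_scale[OF subspace_FS] by blast
    next
      fix k x assume "k \<in> H" "x \<in> ?W"
      then obtain u where u: "k \<in> H" "x \<in> FS" "u \<in> FS" "D \<mu> u - x \<in> P" by blast
      hence "D \<mu> (tr k u) - tr k x \<in> P"
        using PD(3)[of k "D \<mu> u - x"] by (simp add: D_tr tr_diff)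
      thus "tr k x \<in> ?W" using u tr_FS H_carrier by blast
    qed auto
    moreover have "P \<subseteq> ?W"
    proof
      fix x assume "x \<in> P"
      hence "D \<mu> 0 - x \<in> P" using fun_vs.subspace_neg[OF PD(1)] by (simp add: D_zero)
      thus "x \<in> ?W" using \<open>x \<in> P\<close> PD(2) fun_vs.subspace_0[OF subspace_FS] by blast
    qed
    moreover obtain y where "y \<in> FS" "D \<mu> y \<notin> P" using nonscalar by blast
    moreover hence "D \<mu> y \<in> ?W"
      using D_FS fun_vs.subspace_0[OF PD(1)] by (auto intro!: bexI[of _ y])
    ultimately have "?W = FS" using PD(5) by blast
    thus ?thesis using that by blast
  qed
  obtain m where m: "m \<in> FS" "m \<notin> P" using PD(2,4) by blast
  from surj[OF m(1)] obtain v where v: "\<And>\<mu>. v \<mu> \<in> FS" "\<And>\<mu>. D \<mu> (v \<mu>) - m \<in> P" by metis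
  have "inj v"
  proof (rule injI, rule ccontr)
    fix \<mu> \<nu> assume eq: "v \<mu> = v \<nu>" and ne: "\<mu> \<noteq> \<nu>"
    \<comment> \<open>Subtracting the two resolvent equations for the common vector puts a nonzero
      multiple of it into \<open>P\<close>, which would force m \<in> P.\<close>
    have "fscale (\<nu> - \<mu>) (v \<mu>) = (D \<mu> (v \<mu>) - m) - (D \<nu> (v \<nu>) - m)"
      by (simp add: D_def eq fun_vs.scale_left_diff_distrib)
    also have "\<dots> \<in> P" by (intro fun_vs.subspace_diff PD(1) v(2))
    finally have "v \<mu> \<in> P"
      using fun_vs.subspace_scale[OF PD(1), of _ "inverse (\<nu> - \<mu>)"] ne by fastforce
    hence "m \<in> P" using fun_vs.subspace_diff[OF PD(1) D_P v(2), of "v \<mu>" \<mu> \<mu>] by simp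
    with m(2) show False by simp
  qed
  have "finite {x. v \<mu> x \<noteq> 0}" "{x. v \<mu> x \<noteq> 0} \<subseteq> carrier G" for \<mu> using v(1)[of \<mu>] FS_iff by auto
  from uncountable_family_dependent[OF countable_carrier this \<open>inj v\<close>]
  obtain F c \<nu> where F: "finite F" "(\<Sum>\<mu>\<in>F. fscale (c \<mu>) (v \<mu>)) = 0" "\<nu> \<in> F" "c \<nu> \<noteq> 0"
    by blast
  interpret vector_space_operator fscale "tr h"
    by unfold_locales (simp_all add: tr_add tr_scale)
  have "c \<nu> = 0"
    using resolvents_independent[OF PD(1) PD(3)[OF h] subspace_FS tr_FS[OF H_carrier[OF h]]
        inj[unfolded D_def] m v(2)[unfolded D_def] F(1-3)] by simp
  with F(4) show False by simp
qed

section \<open>Finite codimension of maximal left ideals\<close>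

text \<open>As \<open>H\<close> acts on \<open>FS\<close> modulo \<open>P\<close> by scalars, the
  subspace spanned by \<open>P\<close> and \<open>w\<close> is invariant; it exceeds
  \<open>P\<close>, so by maximality it is \<open>FS\<close>.\<close>

lemma codimension_one:
  assumes P: "max_invariant H P" and w: "w \<in> FS" "w \<notin> P" and x: "x \<in> FS"
  obtains c where "x - fscale c w \<in> P"
proof -
  note PD = max_invariantD[OF P]
  let ?W = "{x \<in> FS. \<exists>c. x - fscale c w \<in> P}"
  have "invariant H ?W"
    unfolding invariant_def
  proof (intro conjI fun_vs.subspaceI ballI)
    have "0 - fscale 0 w \<in> P" using fun_vs.subspace_0[OF PD(1)] by simp
    thus "0 \<in> ?W" using fun_vs.subspace_0[OF subspace_FS] by blast
  next
    fix x y assume "x \<in> ?W" "y \<in> ?W"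
    then obtain c d where u: "x \<in> FS" "y \<in> FS" "x - fscale c w \<in> P" "y - fscale d w \<in> P"
      by blast
    hence "(x + y) - fscale (c + d) w \<in> P"
      using fun_vs.subspace_add[OF PD(1) u(3,4)]
      by (simp add: fun_vs.scale_left_distrib algebra_simps)
    thus "x + y \<in> ?W" using u fun_vs.subspace_add[OF subspace_FS] by blast
  next
    fix c x assume "x \<in> ?W"
    then obtain d where u: "x \<in> FS" "x - fscale d w \<in> P" by blast
    hence "fscale c x - fscale (c * d) w \<in> P"
      using fun_vs.subspace_scale[OF PD(1) u(2), of c]
      by (simp add: fun_vs.scale_right_diff_distrib)
    thus "fscale c x \<in> ?W" using u fun_vs.subspace_scale[OF subspace_FS] by blast
  next
    fix k x assume k: "k \<in> H" and "x \<in> ?W"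
    then obtain d where u: "x \<in> FS" "x - fscale d w \<in> P" by blast
    obtain \<mu> where \<mu>: "\<And>x. x \<in> FS \<Longrightarrow> tr k x - fscale \<mu> x \<in> P"
      by (rule scalar_action[OF P k]) (rule that)
    \<comment> \<open>Modulo \<open>P\<close>, translation by \<open>k\<close> multiplies
      \<open>x\<close> by \<mu>, and \<open>x\<close> is congruent to \<open>d\<close> times
      \<open>w\<close>.\<close>
    have "tr k x - fscale (\<mu> * d) w = (tr k x - fscale \<mu> x) + fscale \<mu> (x - fscale d w)"
      by (simp add: fun_vs.scale_right_diff_distrib)
    also have "\<dots> \<in> P"
      using \<mu>[OF u(1)] u(2) by (intro fun_vs.subspace_add fun_vs.subspace_scale PD(1))
    finally show "tr k x \<in> ?W" using u tr_FS k H_carrier by blast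
  qed auto
  moreover have "P \<subseteq> ?W"
  proof
    fix x assume "x \<in> P"
    hence "x - fscale 0 w \<in> P" by simp
    thus "x \<in> ?W" using \<open>x \<in> P\<close> PD(2) by blast
  qed
  moreover have "w \<in> ?W"
  proof -
    have "w - fscale 1 w \<in> P" using fun_vs.subspace_0[OF PD(1)] by simp
    thus ?thesis using w by blast
  qed
  ultimately have "?W = FS" using PD(5) w(2) by blast
  thus thesis using x that by blast
qed

text \<open>Each \<open>g\<close> in \<open>F\<close> imposes one condition, of codimension at most
  one by \<open>codimension_one\<close>, and so costs at most one new vector in
  \<open>E\<close>.\<close>

lemma finite_codimension:
  assumes P: "max_invariant H P" and "finite F" "F \<subseteq> carrier G"
  shows "\<exists>E. finite E \<and> E \<subseteq> FS \<and>
    FS \<subseteq> fun_vs.span (E \<union> {x \<in> FS. \<forall>g\<in>F. tr g x \<in> P})"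
  using assms(2,3)
proof (induction F rule: finite_induct)
  case empty
  have eq: "{} \<union> {x \<in> FS. \<forall>g\<in>{}. tr g x \<in> P} = FS" by auto
  show ?case
  proof (intro exI conjI)
    show "FS \<subseteq> fun_vs.span ({} \<union> {x \<in> FS. \<forall>g\<in>{}. tr g x \<in> P})"
      unfolding eq by (rule fun_vs.span_superset)
  qed auto
next
  case (insert s F)
  note PD = max_invariantD[OF P]
  let ?Q = "{x \<in> FS. \<forall>g\<in>F. tr g x \<in> P}" and ?Q' = "{x \<in> FS. \<forall>g\<in>insert s F. tr g x \<in> P}"
  have Q: "fun_vs.subspace ?Q"
    using fun_vs.subspace_0[OF subspace_FS] fun_vs.subspace_add[OF subspace_FS]
      fun_vs.subspace_scale[OF subspace_FS] fun_vs.subspace_0[OF PD(1)]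
      fun_vs.subspace_add[OF PD(1)] fun_vs.subspace_scale[OF PD(1)]
    by (auto intro!: fun_vs.subspaceI simp: tr_zero tr_add tr_scale)
  obtain E where E: "finite E" "E \<subseteq> FS" "FS \<subseteq> fun_vs.span (E \<union> ?Q)"
    using insert.IH insert.prems by blast
  show ?case
  proof (cases "?Q \<subseteq> ?Q'")
    case True
    hence "?Q' = ?Q" by auto
    thus ?thesis using E by (intro exI[of _ E]) (simp only: simp_thms)
  next
    case False
    then obtain w where w: "w \<in> ?Q" "tr s w \<notin> P" by blast
    have s: "s \<in> carrier G" using insert.prems by auto
    have "?Q \<subseteq> fun_vs.span (insert w E \<union> ?Q')"
    proof
      fix x assume x: "x \<in> ?Q"
      \<comment> \<open>Subtracting a suitable multiple of \<open>w\<close> makes \<open>x\<close>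
        satisfy the new condition for \<open>s\<close> without leaving \<open>?Q\<close>.\<close>
      obtain c where "tr s x - fscale c (tr s w) \<in> P"
        using codimension_one[OF P tr_FS[OF s] w(2) tr_FS[OF s]] x w(1) by blast
      moreover have "x - fscale c w \<in> ?Q"
        using x w by (intro fun_vs.subspace_diff fun_vs.subspace_scale Q)
      ultimately have "x - fscale c w \<in> ?Q'" by (simp add: tr_diff tr_scale)
      hence "(x - fscale c w) + fscale c w \<in> fun_vs.span (insert w E \<union> ?Q')"
        by (intro fun_vs.span_add fun_vs.span_scale fun_vs.span_base) auto
      thus "x \<in> fun_vs.span (insert w E \<union> ?Q')" by simp
    qed
    moreover have "E \<subseteq> fun_vs.span (insert w E \<union> ?Q')" by (auto intro: fun_vs.span_base)
    ultimately have "fun_vs.span (E \<union> ?Q) \<subseteq> fun_vs.span (insert w E \<union> ?Q')"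
      by (intro fun_vs.span_minimal) auto
    hence "FS \<subseteq> fun_vs.span (insert w E \<union> ?Q')" using E(3) by (rule subset_trans[rotated])
    moreover have "finite (insert w E)" "insert w E \<subseteq> FS" using E w(1) by auto
    ultimately show ?thesis by blast
  qed
qed

lemma max_invariant_finite_codimension:
  assumes L: "max_invariant (carrier G) L"
  obtains E where "finite E" "E \<subseteq> FS" "FS \<subseteq> fun_vs.span (E \<union> L)"
proof -
  note LD = max_invariantD[OF L]
  have "invariant H L" using LD(1-3) H_carrier by (auto simp: invariant_def)
  then obtain P where P: "max_invariant H P" "L \<subseteq> P" using max_invariant_exists LD(4) by blast
  note PD = max_invariantD[OF P(1)]
  \<comment> \<open>The largest subspace of \<open>P\<close> invariant under all of
    \<open>G\<close>; maximality of \<open>L\<close> will identify it with \<open>L\<close>.\<close>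
  let ?Q = "{x \<in> FS. \<forall>g\<in>carrier G. tr g x \<in> P}"
  have "invariant (carrier G) ?Q"
    unfolding invariant_def
    using fun_vs.subspace_0[OF subspace_FS] fun_vs.subspace_add[OF subspace_FS]
      fun_vs.subspace_scale[OF subspace_FS] fun_vs.subspace_0[OF PD(1)]
      fun_vs.subspace_add[OF PD(1)] fun_vs.subspace_scale[OF PD(1)] tr_FS
    by (auto intro!: fun_vs.subspaceI simp: tr_zero tr_add tr_scale tr_tr)
  moreover have "L \<subseteq> ?Q" using LD(2,3) P(2) by auto
  moreover have "?Q \<noteq> FS"
  proof
    assume "?Q = FS"
    hence "tr \<one> x \<in> P" if "x \<in> FS" for x using that by blast
    hence "FS \<subseteq> P" using tr_one by auto
    thus False using PD(2,4) by blast
  qed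
  ultimately have "?Q = L" using LD(5) by blast
  \<comment> \<open>Since \<open>P\<close> is \<open>H\<close>-invariant and G = H S, the finitely
    many conditions from \<open>S\<close> imply those from all of \<open>G\<close>.\<close>
  moreover have "{x \<in> FS. \<forall>g\<in>S. tr g x \<in> P} \<subseteq> ?Q"
  proof clarify
    fix x g assume x: "x \<in> FS" "\<forall>g\<in>S. tr g x \<in> P" and "g \<in> carrier G"
    then obtain h s where hs: "h \<in> H" "s \<in> S" "g = h \<otimes> s" using cover by blast
    hence "tr g x = tr h (tr s x)" using H_carrier S_carrier by (auto simp: tr_tr)
    thus "tr g x \<in> P" using hs x PD(3) by simp
  qed
  ultimately have "{x \<in> FS. \<forall>g\<in>S. tr g x \<in> P} \<subseteq> L" by simp
  moreover obtain E where E: "finite E" "E \<subseteq> FS"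
      "FS \<subseteq> fun_vs.span (E \<union> {x \<in> FS. \<forall>g\<in>S. tr g x \<in> P})"
    using finite_codimension[OF P(1) finite_S S_carrier] by blast
  ultimately have "FS \<subseteq> fun_vs.span (E \<union> L)"
    using fun_vs.span_mono[of "E \<union> {x \<in> FS. \<forall>g\<in>S. tr g x \<in> P}" "E \<union> L"] by blast
  thus thesis using that E by blast
qed

section \<open>Primitive quotients of the group algebra\<close>

text \<open>Stated for any ring onto which the group algebra maps, so that the argument lifts ring
  elements along \<open>\<pi>\<close> and never handles cosets.\<close>

lemma simple_quotient:
  assumes M: "simple_module R M" "faithful_module R M"
    and \<pi>: "\<pi> \<in> ring_hom (group_algebra G) R" "carrier R \<subseteq> \<pi> ` FS"
  shows "simple_ring R \<and> (\<exists>L. minimal_left_ideal L R)"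
proof -
  let ?A = "group_algebra G"
  note \<pi>_surj' = \<pi>(2) and \<pi> = \<pi>(1)
  have "left_module R M" using M(1) unfolding simple_module_def by (elim conjE)
  then interpret simple_left_module R M
    by (intro simple_left_module.intro simple_left_module_axioms.intro M(1))
  interpret A: ring ?A by (rule group_algebra_ring) (rule group_axioms)
  have \<pi>_surj: "\<exists>a\<in>FS. r = \<pi> a" if "r \<in> carrier R" for r
    using that \<pi>_surj' by blast
  have \<pi>_closed: "\<pi> a \<in> carrier R" if "a \<in> FS" for a
    using ring_hom_closed[OF \<pi> that] .
  obtain m where m: "m \<in> carrier M" "(\<lambda>a. a \<odot>\<^bsub>M\<^esub> m) ` carrier R = carrier M"
    using simple_module_generated[OF M(1)] by blast
  define act where "act a = (\<pi> a) \<odot>\<^bsub>M\<^esub> m" for a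
  have act_closed: "act a \<in> carrier M" if "a \<in> FS" for a
    unfolding act_def using that m smult_closed \<pi>_closed by simp
  have act_add: "act (a + b) = act a \<oplus>\<^bsub>M\<^esub> act b" if "a \<in> FS" "b \<in> FS" for a b
    using that m ring_hom_add[OF \<pi>, of a b] by (simp add: act_def group_algebra_add smult_l_distr \<pi>_closed)
  have act_mult: "act (a \<otimes>\<^bsub>?A\<^esub> b) = (\<pi> a) \<odot>\<^bsub>M\<^esub> act b" if "a \<in> FS" "b \<in> FS" for a b
    using that m ring_hom_mult[OF \<pi>, of a b] by (simp add: act_def smult_assoc \<pi>_closed)
  have act_surj: "\<exists>a\<in>FS. act a = x" if "x \<in> carrier M" for x
  proof -
    have "x \<in> (\<lambda>a. a \<odot>\<^bsub>M\<^esub> m) ` carrier R" using that m(2) by simp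
    then obtain r where "r \<in> carrier R" "x = r \<odot>\<^bsub>M\<^esub> m" by (rule imageE)
    thus ?thesis using \<pi>_surj unfolding act_def by blast
  qed
  have act_zero: "act 0 = \<zero>\<^bsub>M\<^esub>"
    using m ring_hom_zero[OF \<pi> A.ring_axioms R.ring_axioms] smult_l_zero by (simp add: act_def group_algebra_zero)
  have mult_FS: "a \<otimes>\<^bsub>?A\<^esub> b \<in> FS" if "a \<in> FS" "b \<in> FS" for a b
    using that by simp
  \<comment> \<open>The annihilator of the generator \<open>m\<close> in the group algebra;
    \<open>act\<close> identifies \<open>FS\<close> modulo \<open>L\<close> with
    \<open>M\<close>.\<close>
  define L where "L = {a \<in> FS. act a = \<zero>\<^bsub>M\<^esub>}"
  have L_mult: "a \<otimes>\<^bsub>?A\<^esub> b \<in> L" if "a \<in> FS" "b \<in> L" for a b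
    using that by (auto simp: L_def act_mult smult_r_zero \<pi>_closed)
  have L_add: "a + b \<in> L" if "a \<in> L" "b \<in> L" for a b
    using that fun_vs.subspace_add[OF subspace_FS] by (auto simp: L_def act_add)
  have L_FS: "L \<subseteq> FS" by (auto simp: L_def)
  have L_scale: "fscale c x \<in> L" if "x \<in> L" for c x
    using L_mult[of "fscale c (point \<one>)" x] scaled_point_mult[of \<one> x c] that L_FS tr_one
      fun_vs.subspace_scale[OF subspace_FS point_FS] by auto
  have sub_L: "fun_vs.subspace L"
    using L_add L_scale act_zero fun_vs.subspace_0[OF subspace_FS]
    by (intro fun_vs.subspaceI) (auto simp: L_def)
  have L_tr: "tr g x \<in> L" if "x \<in> L" "g \<in> carrier G" for g x
    using L_mult[of "point g" x] scaled_point_mult[of g x 1] that L_FS point_FS by auto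
  have "max_invariant (carrier G) L"
    unfolding max_invariant_def
  proof (intro conjI allI impI)
    show "invariant (carrier G) L" using sub_L L_FS L_tr by (auto simp: invariant_def)
    show "L \<noteq> FS"
    proof
      assume "L = FS"
      hence "carrier M \<subseteq> {\<zero>\<^bsub>M\<^esub>}" using act_surj by (auto simp: L_def)
      thus False using M(1) smult_closed unfolding simple_module_def by blast
    qed
  next
    fix W assume W: "invariant (carrier G) W" "L \<subseteq> W"
    have WFS: "W \<subseteq> FS" and sub_W: "fun_vs.subspace W" using W by (auto simp: invariant_def)
    \<comment> \<open>Invariant subspaces between \<open>L\<close> and \<open>FS\<close> correspond
      to submodules of \<open>M\<close>, so simplicity of \<open>M\<close> makes \<open>L\<close>
      maximal.\<close>
    have "submodule (act ` W) R M"
    proof (rule submodule_if_closed)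
      show "act ` W \<subseteq> carrier M" using WFS act_closed by auto
      show "act ` W \<noteq> {}" using fun_vs.subspace_0[OF sub_W] by auto
    next
      fix x y assume "x \<in> act ` W" "y \<in> act ` W"
      then obtain a b where ab: "a \<in> W" "b \<in> W" "x = act a" "y = act b" by blast
      hence "x \<oplus>\<^bsub>M\<^esub> y = act (a + b)"
        using act_add[OF subsetD[OF WFS ab(1)] subsetD[OF WFS ab(2)]] by simp
      thus "x \<oplus>\<^bsub>M\<^esub> y \<in> act ` W" using ab fun_vs.subspace_add[OF sub_W] by blast
    next
      fix r x assume "r \<in> carrier R" "x \<in> act ` W"
      then obtain a b where ab: "a \<in> FS" "b \<in> W" "r = \<pi> a" "x = act b" using \<pi>_surj by blast
      hence "r \<odot>\<^bsub>M\<^esub> x = act (a \<otimes>\<^bsub>?A\<^esub> b)"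
        using act_mult[OF ab(1) subsetD[OF WFS ab(2)]] by simp
      thus "r \<odot>\<^bsub>M\<^esub> x \<in> act ` W" using ab invariant_mult[OF W(1)] by blast
    next
      fix x assume "x \<in> act ` W"
      thus "\<one>\<^bsub>R\<^esub> \<odot>\<^bsub>M\<^esub> x = x" using WFS act_closed smult_one by blast
    qed
    hence "act ` W = {\<zero>\<^bsub>M\<^esub>} \<or> act ` W = carrier M" using M(1) by (auto simp: simple_module_def)
    thus "W = L \<or> W = FS"
    proof
      assume "act ` W = {\<zero>\<^bsub>M\<^esub>}"
      thus ?thesis using W(2) WFS by (auto simp: L_def)
    next
      assume full: "act ` W = carrier M"
      have "a \<in> W" if a: "a \<in> FS" for a
      proof -
        obtain w where w: "w \<in> W" "act w = act a" using full act_closed[OF a] by (metis imageE)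
        have d: "a - w \<in> FS" using a w WFS by (intro fun_vs.subspace_diff subspace_FS) auto
        have "act (a - w) \<oplus>\<^bsub>M\<^esub> act w = act w" using act_add[OF d subsetD[OF WFS w(1)]] w by simp
        moreover have "act (a - w) \<in> carrier M" "act w \<in> carrier M" using act_closed[OF d] act_closed[OF a] w(2) by simp_all
        ultimately have "act (a - w) = \<zero>\<^bsub>M\<^esub>" by simp
        hence "a - w \<in> W" using d W(2) by (auto simp: L_def)
        thus ?thesis using fun_vs.subspace_add[OF sub_W _ w(1)] by fastforce
      qed
      thus ?thesis using WFS by blast
    qed
  qed
  then obtain E where E: "finite E" "E \<subseteq> FS" "FS \<subseteq> fun_vs.span (E \<union> L)"
    using max_invariant_finite_codimension by blast
  show ?thesis
  proof (rule simple_ring_minimal_left_idealI[OF M(1)])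
    show "finite (act ` E)" "act ` E \<subseteq> carrier M" using E act_closed by auto
  next
    fix r assume r: "r \<in> carrier R" "\<And>e. e \<in> act ` E \<Longrightarrow> r \<odot>\<^bsub>M\<^esub> e = \<zero>\<^bsub>M\<^esub>"
    obtain a where a: "a \<in> FS" "r = \<pi> a" using \<pi>_surj[OF r(1)] by blast
    \<comment> \<open>\<open>?V\<close> consists of the \<open>x\<close> for which \<open>r\<close>
      kills \<open>act x\<close>. Left multiplication by \<open>a\<close> is complex linear, so
      \<open>?V\<close> is a subspace; containing \<open>E\<close> and \<open>L\<close>, it is all
      of \<open>FS\<close>. Thus \<open>r\<close> kills \<open>M\<close>, and faithfulness
      applies.\<close>
    let ?V = "{x \<in> FS. a \<otimes>\<^bsub>?A\<^esub> x \<in> L}"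
    have "a \<otimes>\<^bsub>?A\<^esub> e \<in> L" if "e \<in> E" for e
      using r(2)[of "act e"] that a(2) act_mult[OF a(1) subsetD[OF E(2) that]]
        mult_FS[OF a(1) subsetD[OF E(2) that]] by (simp add: L_def)
    hence "E \<union> L \<subseteq> ?V" using E(2) L_FS L_mult a by auto
    moreover have "fun_vs.subspace ?V"
    proof (rule fun_vs.subspaceI)
      have "a \<otimes>\<^bsub>?A\<^esub> 0 = 0" using A.r_null[OF a(1)] by (simp add: group_algebra_zero)
      thus "0 \<in> ?V" using fun_vs.subspace_0[OF subspace_FS] fun_vs.subspace_0[OF sub_L] by simp
    qed (use a fun_vs.subspace_add[OF subspace_FS] fun_vs.subspace_scale[OF subspace_FS] L_add L_scale
        in \<open>auto simp: mult_add_right mult_scale_right\<close>)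
    ultimately have "FS \<subseteq> ?V" using E(3) fun_vs.span_minimal by blast
    hence "r \<odot>\<^bsub>M\<^esub> x = \<zero>\<^bsub>M\<^esub>" if "x \<in> carrier M" for x
      using act_surj[OF that] act_mult[OF a(1)] a(2) by (auto simp: L_def)
    thus "r = \<zero>\<^bsub>R\<^esub>" using M(2) r(1) by (auto simp: faithful_module_def)
  qed
qed

lemma primitive_quotient:
  assumes I: "ideal I (group_algebra G)" and prim: "primitive_ring (group_algebra G Quot I)"
  shows "simple_ring (group_algebra G Quot I) \<and>
    (\<exists>L. minimal_left_ideal L (group_algebra G Quot I))"
proof -
  let ?A = "group_algebra G"
  obtain M :: "(('a \<Rightarrow> complex) set, ('a \<Rightarrow> complex) set set) module"
    where "simple_module (?A Quot I) M" "faithful_module (?A Quot I) M"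
    using prim unfolding primitive_ring_def by blast
  moreover have "carrier (?A Quot I) \<subseteq> (+>\<^bsub>?A\<^esub>) I ` FS"
    by (auto simp: FactRing_def A_RCOSETS_def')
  ultimately show ?thesis using simple_quotient ideal.rcos_ring_hom[OF I] by blast
qed

end

theorem corollary4p3:
  fixes G :: "('g, 'b) monoid_scheme"
  assumes "group G" and "countable (carrier G)" and "virtually_abelian G"
  shows "CCR_ring (group_algebra G)"
proof -
  interpret group G by fact
  obtain H where H: "subgroup H G" "comm_group (G\<lparr>carrier := H\<rparr>)" "finite (rcosets\<^bsub>G\<^esub> H)"
    using assms(3) unfolding virtually_abelian_def by blast
  have "rcosets\<^bsub>G\<^esub> H = (\<lambda>g. H #>\<^bsub>G\<^esub> g) ` carrier G" by (auto simp: RCOSETS_def)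
  \<comment> \<open>\<open>S\<close> collects representatives of the finitely many right cosets; H g
    = H s then puts \<open>g\<close> into H s.\<close>
  then obtain S where S: "S \<subseteq> carrier G" "finite S" "(\<lambda>g. H #>\<^bsub>G\<^esub> g) ` carrier G = (\<lambda>g. H #>\<^bsub>G\<^esub> g) ` S"
    using finite_subset_image[of "rcosets\<^bsub>G\<^esub> H" "\<lambda>g. H #>\<^bsub>G\<^esub> g" "carrier G"] H(3) by auto
  interpret abelian_transversal G H S
  proof (intro abelian_transversal.intro abelian_transversal_axioms.intro)
    fix h k assume "h \<in> H" "k \<in> H"
    thus "h \<otimes>\<^bsub>G\<^esub> k = k \<otimes>\<^bsub>G\<^esub> h"
      using comm_monoid.m_comm[OF comm_group.axioms(1)[OF H(2)], of h k] by simp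
  next
    fix g assume g: "g \<in> carrier G"
    then obtain s where "s \<in> S" "H #>\<^bsub>G\<^esub> g = H #>\<^bsub>G\<^esub> s" using S(3) by blast
    moreover have "g \<in> H #>\<^bsub>G\<^esub> g" using rcos_self[OF g H(1)] .
    ultimately show "\<exists>h\<in>H. \<exists>s\<in>S. g = h \<otimes>\<^bsub>G\<^esub> s" by (auto simp: r_coset_def)
  qed (use H S assms in auto)
  show ?thesis
    unfolding CCR_ring_def using group_algebra_ring[OF assms(1)] primitive_quotient by blast
qed

end
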